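(* For $\omega\in(2^{\mathbb N})^{\mathbb N}$ the following are equivalent: (1) $\omega$ is not Doob random; (2) $(M_n(\omega))$ diverges as $n\to\infty$ for some computable rational-valued nonnegative martingale $(M_n)$; (3) $\limsup_nM_n(\omega)=\infty$ for some computable rational-valued nonnegative martingale $(M_n)$; (4) $\liminf_nM_n(\omega)=\infty$ for some computable rational-valued nonnegative martingale $(M_n)$.
   Context: $(2^{\mathbb N})^{\mathbb N}$ carries the uniform (fair-coin product) measure $\mathbb P$. For $\omega=(\omega_0,\omega_1,\dots)$: $\omega_{<n}=(\omega_0,\dots,\omega_{n-1})$, $\omega_{<n}{}^\frown\xi=(\omega_0,\dots,\omega_{n-1},\xi_0,\xi_1,\dots)$, and for integrable $f$, $\mathbb E_n(f)(\omega)=\int f(\omega_{<n}{}^\frown\xi)\,d\mathbb P(\xi)$. A martingale is a sequence $(M_n)$ of integrable real functions such that a.s. $M_n(\omega)$ depends only on $n$ and $\omega_{<n}$, and $\mathbb E_m(M_n)=M_m$ for $m\le n$; it is computable if $M_n(\omega)$ is uniformly computable from $n$ and $\omega_{<n}$. It is rational-valued computable if each $M_n$ is a computable rational-valued function uniformly in $n$, where $f$ is a computable rational-valued function if $f(\omega)=q_{g(\omega)}$ for a fixed computable enumeration $(q_i)$ of $\mathbb Q$ and a computable $g:(2^{\mathbb N})^{\mathbb N}\to\mathbb N$. $\omega$ is Doob random if $(M_n(\omega))$ converges to a real number for every nonnegative computable martingale. "Diverges" means does not converge to a real number. *)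

theory Defs
  imports "HOL-Probability.Probability" "HOL-Library.Nat_Bijection"
begin

section \<open>The sample space\<close>

type_synonym point = "nat \<Rightarrow> nat \<Rightarrow> bool"

definition cantor_measure :: "(nat \<Rightarrow> bool) measure" where
  "cantor_measure = PiM UNIV (\<lambda>_. measure_pmf (pmf_of_set (UNIV :: bool set)))"

definition unif :: "point measure" where
  "unif = PiM UNIV (\<lambda>_. cantor_measure)"

text \<open>
  In the next definition \<open>comb_seq n \<omega> \<xi>\<close> is the library's
  \<open>(\<omega> 0, \<dots>, \<omega> (n - 1), \<xi> 0, \<xi> 1, \<dots>)\<close>.
\<close>

definition cond_E :: "nat \<Rightarrow> (point \<Rightarrow> real) \<Rightarrow> point \<Rightarrow> real" where
  "cond_E n f \<omega> = (\<integral>\<xi>. f (comb_seq n \<omega> \<xi>) \<partial>unif)"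

definition martingale :: "(nat \<Rightarrow> point \<Rightarrow> real) \<Rightarrow> bool" where
  "martingale M \<longleftrightarrow>
     (\<forall>n. integrable unif (M n)) \<and>
     (\<exists>N :: nat \<Rightarrow> (nat \<Rightarrow> bool) list \<Rightarrow> real.
        AE \<omega> in unif. \<forall>n. M n \<omega> = N n (map \<omega> [0..<n])) \<and>
     (\<forall>m n. m \<le> n \<longrightarrow> (AE \<omega> in unif. cond_E m (M n) \<omega> = M m \<omega>))"

definition nonneg :: "(nat \<Rightarrow> point \<Rightarrow> real) \<Rightarrow> bool" where
  "nonneg M \<longleftrightarrow> (\<forall>n \<omega>. 0 \<le> M n \<omega>)"

section \<open>Computability\<close>

text \<open>
  \<open>recursive_functional k F\<close>: the total functional \<open>F\<close> of an oracle and of \<open>k\<close> natural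
  numbers is recursive. This is the class of general recursive functionals, presented as in
  Shoenfield's Mathematical Logic: the least class containing the initial functionals and the
  oracle, closed under substitution, primitive recursion, and minimisation of functionals that
  have a zero for all arguments and all oracles. By the Kleene normal form theorem these are
  exactly the total functionals computed by oracle machines. Only the values on argument lists
  of length \<open>k\<close> are meaningful.
\<close>

inductive recursive_functional :: "nat \<Rightarrow> (point \<Rightarrow> nat list \<Rightarrow> nat) \<Rightarrow> bool" where
  zero: "recursive_functional k (\<lambda>\<omega> xs. 0)"
| succ: "recursive_functional 1 (\<lambda>\<omega> xs. Suc (xs ! 0))"
| proj: "i < k \<Longrightarrow> recursive_functional k (\<lambda>\<omega> xs. xs ! i)"
| query: "recursive_functional 2 (\<lambda>\<omega> xs. of_bool (\<omega> (xs ! 0) (xs ! 1)))"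
| subst: "recursive_functional (length Gs) F \<Longrightarrow>
    (\<And>G. G \<in> set Gs \<Longrightarrow> recursive_functional k G) \<Longrightarrow>
    recursive_functional k (\<lambda>\<omega> xs. F \<omega> (map (\<lambda>G. G \<omega> xs) Gs))"
| prim_rec: "recursive_functional k G \<Longrightarrow> recursive_functional (Suc (Suc k)) H \<Longrightarrow>
    recursive_functional (Suc k)
      (\<lambda>\<omega> xs. rec_nat (G \<omega> (tl xs)) (\<lambda>m r. H \<omega> (m # r # tl xs)) (hd xs))"
| minimise: "recursive_functional (Suc k) F \<Longrightarrow>
    (\<And>\<omega> xs. length xs = k \<Longrightarrow> \<exists>y. F \<omega> (y # xs) = 0) \<Longrightarrow>
    recursive_functional k (\<lambda>\<omega> xs. LEAST y. F \<omega> (y # xs) = 0)"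

definition rat_enum :: "nat \<Rightarrow> rat" where
  "rat_enum i = (case prod_decode i of (a, b) \<Rightarrow> of_int (int_decode a) / of_nat (Suc b))"

lemma surj_rat_enum: "surj rat_enum"
proof (rule surjI)
  fix r :: rat
  obtain p d where q: "quotient_of r = (p, d)" by (cases "quotient_of r")
  then have "d > 0" and r: "r = of_int p / of_int d"
    by (auto simp: quotient_of_denom_pos quotient_of_div)
  then have "of_nat (Suc (nat d - 1)) = (of_int d :: rat)"
    by (simp add: Suc_diff_le flip: of_nat_Suc)
  then show "rat_enum ((\<lambda>r. case quotient_of r of
      (p, d) \<Rightarrow> prod_encode (int_encode p, nat d - 1)) r) = r"
    by (simp add: rat_enum_def q del: of_nat_Suc) (simp add: r)
qed

text \<open>
  \<open>M n \<omega>\<close> is computable as a real uniformly in \<open>n\<close> and \<open>\<omega> 0, \<dots>, \<omega> (n - 1)\<close>: from \<open>n\<close>, a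
  precision \<open>k\<close> and this finite sequence as oracle, one computes (an index of) a rational within
  \<open>2 ^ - k\<close> of \<open>M n \<omega>\<close>. The finite sequence is presented as a point by padding it with zeros.
\<close>

definition computable_martingale :: "(nat \<Rightarrow> point \<Rightarrow> real) \<Rightarrow> bool" where
  "computable_martingale M \<longleftrightarrow> martingale M \<and>
     (\<exists>F. recursive_functional 2 F \<and>
        (\<forall>n k \<omega>. \<bar>M n \<omega> - of_rat (rat_enum (F (comb_seq n \<omega> (\<lambda>_ _. False)) [n, k]))\<bar>
                  \<le> 1 / 2 ^ k))"

definition rational_computable_martingale :: "(nat \<Rightarrow> point \<Rightarrow> real) \<Rightarrow> bool" where
  "rational_computable_martingale M \<longleftrightarrow> martingale M \<and>
     (\<exists>G. recursive_functional 1 G \<and> (\<forall>n \<omega>. M n \<omega> = of_rat (rat_enum (G \<omega> [n]))))"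

definition Doob_random :: "point \<Rightarrow> bool" where
  "Doob_random \<omega> \<longleftrightarrow>
     (\<forall>M. computable_martingale M \<and> nonneg M \<longrightarrow> convergent (\<lambda>n. M n \<omega>))"

end

(*
  Points of the sample space form a compact space, so a recursive functional depends, for fixed
  numerical arguments, on finitely many bits, and how many suffice can be computed. A computable
  nonnegative martingale can therefore be replaced by a rational-valued one: conditional
  expectations of its locally constant rational approximations are finite averages, and
  subtracting them leaves an exactly fair rational process at a convergent distance from the
  original one.

  A divergent nonnegative rational martingale either tends to infinity or crosses some rational
  interval [a, b] infinitely often; in the second case the martingale transform which buys one
  share below a and sells it above b stays nonnegative and tends to infinity.
*)
theory Submission
  imports Defs
begin

text \<open>Divergence has to be produced at one given point, where a statement that holds almost
  surely says nothing by itself; it becomes usable because a condition that depends on finitely many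
  bits and holds almost surely holds everywhere. Rational values serve two purposes. Buying below a
  threshold needs an exact comparison, which is undecidable for computable reals, and the increments
  of the new process must average to exactly zero. The obstacle to exactness is that a single
  coordinate is a whole sequence of bits, so a conditional expectation integrates over Cantor space;
  it turns into a finite sum only after a sufficient number of bits has been computed. This is why
  the recursion theory carries a modulus along and lets a computed oracle replace the given one: the
  modulus has to be evaluated at finitely many test rows.\<close>

section \<open>Functions of finitely many bits\<close>

text \<open>One number bounds rows and columns at once, so that a modulus of continuity is a single
  number.\<close>

definition agree :: "nat \<Rightarrow> point \<Rightarrow> point \<Rightarrow> bool" where
  "agree B \<omega> \<omega>' \<longleftrightarrow> (\<forall>i<B. \<forall>j<B. \<omega> i j = \<omega>' i j)"

lemma agree_mono: "agree B \<omega> \<omega>' \<Longrightarrow> C \<le> B \<Longrightarrow> agree C \<omega> \<omega>'"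
  unfolding agree_def by auto


definition finitely_determined :: "(point \<Rightarrow> 'a) \<Rightarrow> bool" where
  "finitely_determined f \<longleftrightarrow> (\<exists>B. \<forall>\<omega> \<omega>'. agree B \<omega> \<omega>' \<longrightarrow> f \<omega> = f \<omega>')"

lemma agree_refl: "agree B \<omega> \<omega>"
  and agree_trans: "agree B \<omega> \<omega>' \<Longrightarrow> agree B \<omega>' \<omega>'' \<Longrightarrow> agree B \<omega> \<omega>''"
  unfolding agree_def by auto

lemma open_agree: "open {\<omega>'. agree B \<omega> \<omega>'}"
proof -
  have "open ((\<lambda>\<omega>' :: point. \<omega>' i j) -` {\<omega> i j})" for i j
  proof (rule open_vimage)
    have "continuous_on UNIV ((\<lambda>x :: nat \<Rightarrow> bool. x j) \<circ> (\<lambda>\<omega>' :: point. \<omega>' i))"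
      by (intro continuous_on_compose continuous_on_product_coordinates)
        (auto intro: continuous_on_subset[OF continuous_on_product_coordinates])
    then show "continuous_on UNIV (\<lambda>\<omega>' :: point. \<omega>' i j)" by (simp add: comp_def)
    show "open {\<omega> i j}" by (rule discrete_topology_class.open_discrete)
  qed
  moreover have "{\<omega>'. agree B \<omega> \<omega>'} = (\<Inter>i\<in>{..<B}. \<Inter>j\<in>{..<B}. (\<lambda>\<omega>' :: point. \<omega>' i j) -` {\<omega> i j})"
    by (auto simp: agree_def)
  ultimately show ?thesis by (simp add: open_INT)
qed

text \<open>Tychonoff's theorem, first for a row and then for the sequence of rows.\<close>

lemma compact_UNIV_point: "compact (UNIV :: point set)"
proof -
  have 1: "compact_space (euclidean :: bool topology)"
    by (simp add: compact_space_def finite_imp_compact)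
  have 2: "compact_space (euclidean :: (nat \<Rightarrow> bool) topology)"
    unfolding euclidean_product_topology[symmetric]
    using 1 by (simp add: compact_space_product_topology)
  have "compact_space (euclidean :: point topology)"
    using 2 compact_space_product_topology[of "\<lambda>_. euclidean" "UNIV :: nat set"]
    unfolding euclidean_product_topology by blast
  then show ?thesis by (simp add: compact_space_def)
qed

text \<open>Compactness makes a modulus that varies with the point uniform: the maximum over the
  centres of a finite subcover works, because both points then agree with the same centre.\<close>

lemma finitely_determined_of_modulus:
  assumes "\<And>\<omega> \<omega>'. agree (m \<omega>) \<omega> \<omega>' \<Longrightarrow> f \<omega>' = f \<omega>"
  shows "finitely_determined f"
proof -
  obtain D where D: "finite D" "UNIV \<subseteq> (\<Union>\<omega>\<in>D. {\<omega>'. agree (m \<omega>) \<omega> \<omega>'})"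
  proof (rule compactE_image[OF compact_UNIV_point, of UNIV "\<lambda>\<omega>. {\<omega>'. agree (m \<omega>) \<omega> \<omega>'}"])
    show "UNIV \<subseteq> (\<Union>\<omega>. {\<omega>'. agree (m \<omega>) \<omega> \<omega>'})"
      using agree_refl by blast
  qed (auto simp: open_agree)
  show ?thesis
    unfolding finitely_determined_def
  proof (intro exI allI impI)
    fix \<omega> \<omega>' assume ag: "agree (Max (m ` D)) \<omega> \<omega>'"
    obtain \<alpha> where \<alpha>: "\<alpha> \<in> D" "agree (m \<alpha>) \<alpha> \<omega>" using D(2) by auto
    moreover have "agree (m \<alpha>) \<omega> \<omega>'"
      using ag \<alpha>(1) D(1) by (intro agree_mono[OF ag]) simp
    ultimately show "f \<omega> = f \<omega>'"
      using assms agree_trans by metis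
  qed
qed

text \<open>A canonical representative of the points with the same first bits. A finitely determined
  function factors through this map, which has finite range.\<close>

definition restrict_point :: "nat \<Rightarrow> point \<Rightarrow> point" where
  "restrict_point B \<omega> = (\<lambda>i j. i < B \<and> j < B \<and> \<omega> i j)"

lemma restrict_point_eq_iff: "restrict_point B \<omega> = restrict_point B \<omega>' \<longleftrightarrow> agree B \<omega> \<omega>'"
  unfolding restrict_point_def agree_def fun_eq_iff by auto

lemma agree_restrict_point: "agree B \<omega> (restrict_point B \<omega>)"
  unfolding restrict_point_def agree_def by auto

lemma finite_range_restrict_point: "finite (range (restrict_point B))"
proof (rule finite_subset)
  show "range (restrict_point B) \<subseteq> (\<lambda>S i j. (i, j) \<in> S) ` Pow ({..<B} \<times> {..<B})"
  proof safe
    fix \<omega>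
    show "restrict_point B \<omega> \<in> (\<lambda>S i j. (i, j) \<in> S) ` Pow ({..<B} \<times> {..<B})"
      by (rule image_eqI[of _ _ "{(i, j). restrict_point B \<omega> i j}"]) (auto simp: restrict_point_def)
  qed
qed simp

lemma finite_range_finitely_determined: "finitely_determined f \<Longrightarrow> finite (range f)"
proof -
  assume "finitely_determined f"
  then obtain B where "\<And>\<omega> \<omega>'. agree B \<omega> \<omega>' \<Longrightarrow> f \<omega> = f \<omega>'" unfolding finitely_determined_def by blast
  then have "f \<omega> = f (restrict_point B \<omega>)" for \<omega> using agree_restrict_point by blast
  then have "range f \<subseteq> f ` range (restrict_point B)" by blast
  then show ?thesis using finite_range_restrict_point finite_subset by blast
qed

lemma finitely_determined_compose:
  "finitely_determined f \<Longrightarrow> finitely_determined (\<lambda>\<omega>. h (f \<omega>))"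
  unfolding finitely_determined_def by metis

lemma finitely_determined_compose2:
  assumes "finitely_determined f" "finitely_determined g"
  shows "finitely_determined (\<lambda>\<omega>. h (f \<omega>) (g \<omega>))"
proof -
  obtain B C where "\<And>\<omega> \<omega>'. agree B \<omega> \<omega>' \<Longrightarrow> f \<omega> = f \<omega>'" "\<And>\<omega> \<omega>'. agree C \<omega> \<omega>' \<Longrightarrow> g \<omega> = g \<omega>'"
    using assms unfolding finitely_determined_def by metis
  then show ?thesis
    unfolding finitely_determined_def
    by (intro exI[of _ "max B C"]) (metis agree_mono max.cobounded1 max.cobounded2)
qed

section \<open>The uniform measure and conditional expectations of finitely determined
  functions\<close>

lemma prob_space_cantor_measure: "prob_space cantor_measure"
  unfolding cantor_measure_def by (intro prob_space_PiM prob_space_measure_pmf)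

lemma prob_space_unif: "prob_space unif"
  unfolding unif_def by (intro prob_space_PiM prob_space_cantor_measure)

lemma space_cantor_measure: "space cantor_measure = UNIV"
  by (auto simp: cantor_measure_def space_PiM)

lemma space_unif: "space unif = UNIV"
  by (auto simp: unif_def space_PiM space_cantor_measure)

interpretation unif: prob_space unif by (rule prob_space_unif)

lemma emeasure_cylinder_cantor:
  "{x. \<forall>j<N. x j = c j} \<in> sets cantor_measure \<and>
    emeasure cantor_measure {x. \<forall>j<N. x j = c j} = ennreal ((1 / 2) ^ N)"
proof -
  let ?p = "measure_pmf (pmf_of_set (UNIV :: bool set))"
  interpret product_prob_space "\<lambda>_ :: nat. ?p" UNIV
    by standard
  have eq: "{x. \<forall>j<N. x j = c j} = {x \<in> space cantor_measure. \<forall>j\<in>{..<N}. x j \<in> {c j}}"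
    by (auto simp: space_cantor_measure)
  have "emeasure cantor_measure {x. \<forall>j<N. x j = c j} = (\<Prod>j<N. emeasure ?p {c j})"
    unfolding eq cantor_measure_def by (rule emeasure_PiM_Collect) auto
  also have "\<dots> = (\<Prod>j<N. ennreal (1 / 2))"
    by (intro prod.cong refl) (simp add: emeasure_pmf_single)
  also have "\<dots> = ennreal ((1 / 2) ^ N)"
    by (subst prod_ennreal) simp_all
  finally have "emeasure cantor_measure {x. \<forall>j<N. x j = c j} = ennreal ((1 / 2) ^ N)" .
  moreover have "{x. \<forall>j<N. x j = c j} \<in> sets cantor_measure"
    unfolding eq unfolding cantor_measure_def
    by (intro sets.sets_Collect_finite_All sets_Collect_single) auto
  ultimately show ?thesis by simp
qed

lemma emeasure_cylinder:
  "{\<xi>. \<forall>i<n. \<forall>j<N. \<xi> i j = c i j} \<in> sets unif \<and>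
    emeasure unif {\<xi>. \<forall>i<n. \<forall>j<N. \<xi> i j = c i j} = ennreal ((1 / 2) ^ (N * n))"
proof -
  interpret cantor: prob_space cantor_measure by (rule prob_space_cantor_measure)
  interpret product_prob_space "\<lambda>_ :: nat. cantor_measure" UNIV
    by standard
  let ?C = "\<lambda>i. {x. \<forall>j<N. x j = c i j}"
  have eq: "{\<xi>. \<forall>i<n. \<forall>j<N. \<xi> i j = c i j} = {\<xi> \<in> space unif. \<forall>i\<in>{..<n}. \<xi> i \<in> ?C i}"
    by (auto simp: space_unif)
  have C: "?C i \<in> sets cantor_measure" for i
    using emeasure_cylinder_cantor by blast
  have "emeasure unif {\<xi>. \<forall>i<n. \<forall>j<N. \<xi> i j = c i j} = (\<Prod>i<n. emeasure cantor_measure (?C i))"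
    unfolding eq unif_def using C by (intro emeasure_PiM_Collect) auto
  also have "\<dots> = (\<Prod>i<n. ennreal ((1 / 2) ^ N))"
    using emeasure_cylinder_cantor by (intro prod.cong refl) blast
  also have "\<dots> = ennreal ((1 / 2) ^ (N * n))"
    by (simp add: ennreal_power power_mult)
  finally have "emeasure unif {\<xi>. \<forall>i<n. \<forall>j<N. \<xi> i j = c i j} = ennreal ((1 / 2) ^ (N * n))" .
  moreover have "{\<xi>. \<forall>i<n. \<forall>j<N. \<xi> i j = c i j} \<in> sets unif"
    unfolding eq unfolding unif_def
    using C by (intro sets.sets_Collect_finite_All sets_Collect_single) auto
  ultimately show ?thesis by simp
qed

text \<open>
  Cylinders have positive measure, so the almost sure clauses in the definition of a martingale
  hold everywhere for locally constant functions.
\<close>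

lemma AE_imp_everywhere:
  assumes ae: "AE \<omega> in unif. P \<omega>" and P: "finitely_determined P"
  shows "P \<omega>"
proof (rule ccontr)
  assume neg: "\<not> P \<omega>"
  obtain B where B: "\<And>\<omega> \<omega>'. agree B \<omega> \<omega>' \<Longrightarrow> P \<omega> = P \<omega>'"
    using P unfolding finitely_determined_def by blast
  let ?C = "{\<xi>. \<forall>i<B. \<forall>j<B. \<xi> i j = \<omega> i j}"
  have C: "\<not> P \<xi>" if "\<xi> \<in> ?C" for \<xi>
    using B[of \<xi> \<omega>] that neg by (auto simp: agree_def)
  have "AE \<xi> in unif. \<xi> \<notin> ?C" by (rule AE_mp[OF ae]) (rule AE_I2, use C in blast)
  then have "emeasure unif ?C = 0"
    using emeasure_cylinder[of B B \<omega>] by (subst (asm) AE_iff_null_sets[symmetric]) auto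
  moreover have "emeasure unif ?C = ennreal ((1 / 2) ^ (B * B))"
    using emeasure_cylinder by blast
  ultimately show False by simp
qed

text \<open>The fibres of \<open>restrict_point B\<close> are cylinders, so this map is a simple
  function, and \<open>f\<close> factors through it.\<close>

lemma measurable_finitely_determined:
  fixes f :: "point \<Rightarrow> real"
  assumes "finitely_determined f"
  shows "f \<in> borel_measurable unif"
proof -
  obtain B where B: "\<And>\<omega> \<omega>'. agree B \<omega> \<omega>' \<Longrightarrow> f \<omega> = f \<omega>'"
    using assms unfolding finitely_determined_def by blast
  have "simple_function unif (restrict_point B)"
    unfolding simple_function_def
  proof safe
    show "finite (restrict_point B ` space unif)"
      using finite_range_restrict_point by (simp add: space_unif)
    fix \<omega> assume "\<omega> \<in> space unif"
    have "restrict_point B -` {restrict_point B \<omega>} \<inter> space unif = {\<xi>. \<forall>i<B. \<forall>j<B. \<xi> i j = \<omega> i j}"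
      by (auto simp: restrict_point_eq_iff space_unif) (auto simp: agree_def)
    then show "restrict_point B -` {restrict_point B \<omega>} \<inter> space unif \<in> sets unif"
      using emeasure_cylinder by simp
  qed
  then have "simple_function unif (f \<circ> restrict_point B)" by (rule simple_function_compose)
  moreover have "f \<circ> restrict_point B = f"
    using B[OF agree_restrict_point] by (auto simp: fun_eq_iff)
  ultimately show ?thesis using borel_measurable_simple_function by metis
qed

lemma bounded_finitely_determined:
  fixes f :: "point \<Rightarrow> real"
  assumes "finitely_determined f"
  obtains b where "\<And>\<omega>. \<bar>f \<omega>\<bar> \<le> b"
proof -
  have "finite (range (\<lambda>\<omega>. \<bar>f \<omega>\<bar>))"
    by (rule finite_range_finitely_determined[OF finitely_determined_compose[OF assms]])
  then have "\<bar>f \<omega>\<bar> \<le> Max (range (\<lambda>\<omega>. \<bar>f \<omega>\<bar>))" for \<omega> by (intro Max_ge) auto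
  then show ?thesis using that by blast
qed

lemma integrable_bounded_unif:
  fixes f :: "point \<Rightarrow> real"
  assumes "f \<in> borel_measurable unif" "\<And>\<omega>. \<bar>f \<omega>\<bar> \<le> b"
  shows "integrable unif f"
  using assms by (intro unif.integrable_const_bound[of _ b]) auto

lemma integrable_finitely_determined:
  fixes f :: "point \<Rightarrow> real"
  assumes "finitely_determined f"
  shows "integrable unif f"
  using assms bounded_finitely_determined measurable_finitely_determined integrable_bounded_unif by metis

lemma measurable_comb_seq_unif: "comb_seq n \<omega> \<in> measurable unif unif"
  unfolding unif_def
  by (rule measurable_comb_seq') (auto simp: space_PiM space_cantor_measure)

lemma agree_comb_seq: "agree B \<omega> \<omega>' \<Longrightarrow> agree B \<xi> \<xi>' \<Longrightarrow> agree B (comb_seq n \<omega> \<xi>) (comb_seq n \<omega>' \<xi>')"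
  unfolding agree_def comb_seq_def by auto

lemma finitely_determined_comb_seq:
  assumes "finitely_determined f"
  shows "finitely_determined (\<lambda>\<xi>. f (comb_seq n \<omega> \<xi>))" "finitely_determined (\<lambda>\<omega>. f (comb_seq n \<omega> \<xi>))"
  using assms agree_comb_seq agree_refl unfolding finitely_determined_def by metis+

lemma finitely_determined_cond_E:
  assumes "finitely_determined f"
  shows "finitely_determined (cond_E n f)"
proof -
  obtain B where B: "\<And>\<omega> \<omega>'. agree B \<omega> \<omega>' \<Longrightarrow> f \<omega> = f \<omega>'"
    using assms unfolding finitely_determined_def by blast
  have "cond_E n f \<omega> = cond_E n f \<omega>'" if "agree B \<omega> \<omega>'" for \<omega> \<omega>'
    unfolding cond_E_def using that agree_comb_seq[OF that agree_refl] B by (metis (no_types, lifting))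
  then show ?thesis unfolding finitely_determined_def by blast
qed

lemma comb_seq_comb_seq: "m \<le> n \<Longrightarrow>
    comb_seq n (comb_seq m \<omega> \<xi>) \<eta> = comb_seq m \<omega> (comb_seq (n - m) \<xi> \<eta>)"
  by (auto simp: comb_seq_def fun_eq_iff)

lemma comb_seq_absorb: "m \<le> n \<Longrightarrow> comb_seq m (comb_seq n \<omega> \<xi>) \<eta> = comb_seq m \<omega> \<eta>"
  by (auto simp: comb_seq_def fun_eq_iff)

text \<open>Splicing two independent points at row \<open>n\<close> preserves the measure; Fubini's
  theorem then integrates over the tail first.\<close>

lemma integral_cond_E:
  assumes f: "finitely_determined f"
  shows "(\<integral>\<xi>. cond_E n f \<xi> \<partial>unif) = (\<integral>\<xi>. f \<xi> \<partial>unif)"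
proof -
  interpret cantor: prob_space cantor_measure by (rule prob_space_cantor_measure)
  interpret sequence_space cantor_measure by standard
  interpret pair: pair_prob_space unif unif by standard
  have meas: "(\<lambda>(\<omega>, \<xi>). comb_seq n \<omega> \<xi>) \<in> measurable (unif \<Otimes>\<^sub>M unif) unif"
    unfolding unif_def by (rule measurable_comb_seq)
  obtain b where b: "\<And>\<omega>. \<bar>f \<omega>\<bar> \<le> b" using bounded_finitely_determined[OF f] by blast
  have "(\<integral>\<xi>. f \<xi> \<partial>unif) = (\<integral>\<xi>. f \<xi> \<partial>distr (unif \<Otimes>\<^sub>M unif) unif (\<lambda>(\<omega>, \<xi>). comb_seq n \<omega> \<xi>))"
    using PiM_comb_seq[of n] by (simp add: unif_def)
  also have "\<dots> = (\<integral>p. f (case p of (\<omega>, \<xi>) \<Rightarrow> comb_seq n \<omega> \<xi>) \<partial>(unif \<Otimes>\<^sub>M unif))"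
    by (intro integral_distr meas measurable_finitely_determined f)
  also have "\<dots> = (\<integral>\<omega>. (\<integral>\<xi>. f (comb_seq n \<omega> \<xi>) \<partial>unif) \<partial>unif)"
  proof -
    have "integrable (unif \<Otimes>\<^sub>M unif) (\<lambda>p. f (case p of (\<omega>, \<xi>) \<Rightarrow> comb_seq n \<omega> \<xi>))"
      using b measurable_compose[OF meas measurable_finitely_determined[OF f]]
      by (intro pair.integrable_const_bound[of _ b]) auto
    from pair.integral_fst'[OF this] show ?thesis by simp
  qed
  finally show ?thesis by (simp add: cond_E_def)
qed

text \<open>With the first \<open>m\<close> rows frozen this is \<open>integral_cond_E\<close> for
  the remaining rows, among which row \<open>n\<close> has become row \<open>n - m\<close>.\<close>

lemma cond_E_cond_E:
  assumes f: "finitely_determined f" and "m \<le> n"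
  shows "cond_E m (cond_E n f) \<omega> = cond_E m f \<omega>"
  using integral_cond_E[OF finitely_determined_comb_seq(1)[OF f, of m \<omega>], of "n - m"] \<open>m \<le> n\<close>
  by (simp add: cond_E_def comb_seq_comb_seq)

text \<open>Turns patterns of \<open>N\<close> bits into an initial segment of the numbers, over
  which a recursive functional can sum.\<close>

lemma ex1_bit_eq: "\<exists>!s. s < 2 ^ N \<and> (\<forall>j<N. bit (s :: nat) j = c j)"
proof (rule ex1I)
  let ?s = "horner_sum of_bool 2 (map c [0..<N]) :: nat"
  have "?s < 2 ^ length (map c [0..<N])" by (rule horner_sum_of_bool_2_less)
  then show "?s < 2 ^ N \<and> (\<forall>j<N. bit ?s j = c j)"
    by (auto simp: bit_horner_sum_bit_iff)
  fix s :: nat assume s: "s < 2 ^ N \<and> (\<forall>j<N. bit s j = c j)"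
  then have "take_bit N s = ?s"
    by (intro bit_eqI) (auto simp: bit_take_bit_iff bit_horner_sum_bit_iff)
  then show "s = ?s" using s by (simp add: take_bit_nat_eq_self)
qed

text \<open>The first \<open>N\<close> bits of row 0 cut the space into \<open>2 ^ N\<close>
  cylinders of equal measure, and the integrand is constant on each.\<close>

lemma integral_first_bits:
  fixes f :: "(nat \<Rightarrow> bool) \<Rightarrow> real"
  assumes f: "\<And>x y. (\<And>j. j < N \<Longrightarrow> x j = y j) \<Longrightarrow> f x = f y"
  shows "(\<integral>\<xi>. f (\<xi> 0) \<partial>unif) = (\<Sum>s<2 ^ N. f (bit (s :: nat))) / 2 ^ N"
proof -
  let ?C = "\<lambda>s :: nat. {\<xi> :: point. \<forall>i<1. \<forall>j<N. \<xi> i j = bit s j}"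
  have C: "?C s \<in> sets unif" "emeasure unif (?C s) = ennreal ((1 / 2) ^ N)" for s
    using emeasure_cylinder[of 1 N "\<lambda>_. bit s"] by simp_all
  have *: "f (\<xi> 0) = (\<Sum>s<2 ^ N. f (bit s) * indicator (?C s) \<xi>)" for \<xi> :: point
  proof -
    obtain s :: nat where s: "s < 2 ^ N" "\<forall>j<N. bit s j = \<xi> 0 j"
      and uniq: "\<And>t. t < 2 ^ N \<Longrightarrow> \<forall>j<N. bit t j = \<xi> 0 j \<Longrightarrow> t = s"
      using ex1_bit_eq[of N "\<xi> 0"] unfolding Ex1_def by auto
    have "(\<Sum>t<2 ^ N. f (bit t) * indicator (?C t) \<xi>) = (\<Sum>t\<in>{s}. f (bit t) * indicator (?C t) \<xi>)"
      using s(1) uniq by (intro sum.mono_neutral_right) (auto simp: indicator_def split: if_splits)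
    also have "\<dots> = f (bit s)" using s(2) by (simp add: indicator_def)
    also have "\<dots> = f (\<xi> 0)" using s(2) by (intro f) auto
    finally show ?thesis by simp
  qed
  have "(\<integral>\<xi>. f (\<xi> 0) \<partial>unif) = (\<Sum>s::nat<2 ^ N. \<integral>\<xi>. f (bit s) * indicator (?C s) \<xi> \<partial>unif)"
    unfolding * using C by (intro Bochner_Integration.integral_sum) (auto intro!: integrable_real_indicator)
  also have "\<dots> = (\<Sum>s::nat<2 ^ N. f (bit s) * (1 / 2) ^ N)"
    using C by (intro sum.cong refl) (simp add: measure_def space_unif)
  also have "\<dots> = (\<Sum>s::nat<2 ^ N. f (bit s)) / 2 ^ N"
    by (simp add: sum_divide_distrib power_one_over)
  finally show ?thesis .
qed

section \<open>Recursive functionals\<close>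

text \<open>
  \<open>recursive_functional\<close> is not closed under changing values on argument lists of the wrong length;
  \<open>recursive\<close> is its closure under such changes. Under a binder the bound variable is pushed onto the
  argument list, hence the premises about \<open>zs ! 0\<close> and \<open>drop 1 zs\<close> below.
\<close>

definition recursive :: "nat \<Rightarrow> (point \<Rightarrow> nat list \<Rightarrow> nat) \<Rightarrow> bool" where
  "recursive k f \<longleftrightarrow>
     (\<exists>F. recursive_functional k F \<and> (\<forall>\<omega> xs. length xs = k \<longrightarrow> f \<omega> xs = F \<omega> xs))"

definition decidable :: "nat \<Rightarrow> (point \<Rightarrow> nat list \<Rightarrow> bool) \<Rightarrow> bool" where
  "decidable k P \<longleftrightarrow> recursive k (\<lambda>\<omega> xs. of_bool (P \<omega> xs))"

lemma recursive_functional_imp_recursive: "recursive_functional k F \<Longrightarrow> recursive k F"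
  unfolding recursive_def by blast

lemma recursive_cong:
  assumes "recursive k f" "\<And>\<omega> xs. length xs = k \<Longrightarrow> f \<omega> xs = g \<omega> xs"
  shows "recursive k g"
  using assms unfolding recursive_def by metis

lemma recursive_subst:
  assumes f: "recursive (length Gs) f" and Gs: "\<And>G. G \<in> set Gs \<Longrightarrow> recursive k G"
  shows "recursive k (\<lambda>\<omega> xs. f \<omega> (map (\<lambda>G. G \<omega> xs) Gs))"
proof -
  obtain F where F: "recursive_functional (length Gs) F"
      "\<And>\<omega> xs. length xs = length Gs \<Longrightarrow> f \<omega> xs = F \<omega> xs"
    using f unfolding recursive_def by blast
  have "\<forall>G\<in>set Gs. \<exists>G'. recursive_functional k G' \<and> (\<forall>\<omega> xs. length xs = k \<longrightarrow> G \<omega> xs = G' \<omega> xs)"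
    using Gs unfolding recursive_def by blast
  then obtain \<phi> where \<phi>: "\<And>G. G \<in> set Gs \<Longrightarrow> recursive_functional k (\<phi> G)"
      "\<And>G \<omega> xs. G \<in> set Gs \<Longrightarrow> length xs = k \<Longrightarrow> G \<omega> xs = \<phi> G \<omega> xs"
    by metis
  have "recursive_functional k (\<lambda>\<omega> xs. F \<omega> (map (\<lambda>G. G \<omega> xs) (map \<phi> Gs)))"
    using F(1) \<phi>(1) by (intro recursive_functional.subst) auto
  moreover have "f \<omega> (map (\<lambda>G. G \<omega> xs) Gs) = F \<omega> (map (\<lambda>G. G \<omega> xs) (map \<phi> Gs))"
    if "length xs = k" for \<omega> xs
  proof -
    have "map (\<lambda>G. G \<omega> xs) Gs = map (\<lambda>G. G \<omega> xs) (map \<phi> Gs)"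
      using \<phi>(2) that by simp
    then show ?thesis using F(2) by (metis length_map)
  qed
  ultimately show ?thesis unfolding recursive_def by blast
qed

lemma recursive_proj: "i < k \<Longrightarrow> recursive k (\<lambda>\<omega> xs. xs ! i)"
  by (intro recursive_functional_imp_recursive recursive_functional.proj)

lemma recursive_proj_drop: "d + i < k \<Longrightarrow> recursive k (\<lambda>\<omega> xs. drop d xs ! i)"
  by (rule recursive_cong[OF recursive_proj[of "d + i"]]) auto

lemma recursive_proj_drop2: "d + (e + i) < k \<Longrightarrow> recursive k (\<lambda>\<omega> xs. drop e (drop d xs) ! i)"
  by (rule recursive_cong[OF recursive_proj[of "d + (e + i)"]]) (auto simp: add_ac)

lemma recursive_map:
  assumes "recursive l f" "\<And>i. i < l \<Longrightarrow> recursive k (g i)"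
  shows "recursive k (\<lambda>\<omega> xs. f \<omega> (map (\<lambda>i. g i \<omega> xs) [0..<l]))"
proof -
  have "recursive k (\<lambda>\<omega> xs. f \<omega> (map (\<lambda>G. G \<omega> xs) (map g [0..<l])))"
    using assms by (intro recursive_subst) auto
  then show ?thesis by (simp add: comp_def)
qed

text \<open>Substitution for argument lists built with \<open>#\<close>, \<open>@\<close> or
  \<open>drop\<close>: a list of known length is rebuilt entry by entry, which brings it into the
  form that \<open>subst\<close> accepts.\<close>

lemma recursive_reindex:
  assumes f: "recursive l f" and g: "\<And>i. i < l \<Longrightarrow> recursive k (\<lambda>\<omega> xs. g \<omega> xs ! i)"
    and len: "\<And>\<omega> xs. length xs = k \<Longrightarrow> length (g \<omega> xs) = l"
  shows "recursive k (\<lambda>\<omega> xs. f \<omega> (g \<omega> xs))"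
proof -
  have "recursive k (\<lambda>\<omega> xs. f \<omega> (map (\<lambda>i. g \<omega> xs ! i) [0..<l]))"
    using f g by (rule recursive_map)
  then show ?thesis
    by (rule recursive_cong) (metis len map_nth)
qed

lemma recursive_comp1:
  "recursive 1 f \<Longrightarrow> recursive k g \<Longrightarrow> recursive k (\<lambda>\<omega> xs. f \<omega> [g \<omega> xs])"
  by (rule recursive_reindex) auto

lemma recursive_comp2:
  "recursive 2 f \<Longrightarrow> recursive k g \<Longrightarrow> recursive k h \<Longrightarrow> recursive k (\<lambda>\<omega> xs. f \<omega> [g \<omega> xs, h \<omega> xs])"
  by (rule recursive_reindex[where l = 2]) (auto simp: less_2_cases_iff)

lemma recursive_push:
  assumes "recursive (Suc k) f" "recursive k n"
  shows "recursive k (\<lambda>\<omega> xs. f \<omega> (n \<omega> xs # xs))"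
proof (rule recursive_reindex[OF assms(1)])
  fix i assume "i < Suc k"
  then show "recursive k (\<lambda>\<omega> xs. (n \<omega> xs # xs) ! i)"
    using assms(2) by (cases i) (auto intro: recursive_proj)
qed simp

lemma recursive_drop:
  "recursive k f \<Longrightarrow> l = k + d \<Longrightarrow> recursive l (\<lambda>\<omega> xs. f \<omega> (drop d xs))"
  by (rule recursive_reindex) (auto intro: recursive_proj_drop)

text \<open>Moves a functional under further binders: position \<open>a\<close> supplies its first
  argument, and its parameters begin at position \<open>d\<close>.\<close>

lemma recursive_skip:
  assumes "recursive (Suc k) f" "l = k + d" "a < l"
  shows "recursive l (\<lambda>\<omega> xs. f \<omega> (xs ! a # drop d xs))"
proof (rule recursive_reindex[OF assms(1)])
  fix i assume "i < Suc k"
  then show "recursive l (\<lambda>\<omega> xs. (xs ! a # drop d xs) ! i)"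
    using assms(2,3) by (cases i) (auto intro: recursive_proj recursive_proj_drop)
qed (use assms in simp)

lemma recursive_const: "recursive k (\<lambda>\<omega> xs. c)"
proof (induction c)
  case 0
  show ?case by (intro recursive_functional_imp_recursive recursive_functional.zero)
next
  case (Suc c)
  have "recursive k (\<lambda>\<omega> xs. Suc ([c] ! 0))"
    by (rule recursive_comp1[OF recursive_functional_imp_recursive[OF recursive_functional.succ] Suc])
  then show ?case by simp
qed

lemma recursive_Suc: "recursive k f \<Longrightarrow> recursive k (\<lambda>\<omega> xs. Suc (f \<omega> xs))"
  using recursive_comp1[OF recursive_functional_imp_recursive[OF recursive_functional.succ], of k f]
  by simp

lemma recursive_query:
  "recursive k f \<Longrightarrow> recursive k g \<Longrightarrow> recursive k (\<lambda>\<omega> xs. of_bool (\<omega> (f \<omega> xs) (g \<omega> xs)))"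
  using recursive_comp2[OF recursive_functional_imp_recursive[OF recursive_functional.query], of k f g]
  by simp

lemma recursive_rec_nat:
  assumes g: "recursive k g" and n: "recursive k n"
    and h: "recursive (Suc (Suc k)) (\<lambda>\<omega> zs. h \<omega> (zs ! 0) (zs ! 1) (drop 2 zs))"
  shows "recursive k (\<lambda>\<omega> xs. rec_nat (g \<omega> xs) (\<lambda>m r. h \<omega> m r xs) (n \<omega> xs))"
proof -
  obtain G where G: "recursive_functional k G" "\<And>\<omega> xs. length xs = k \<Longrightarrow> g \<omega> xs = G \<omega> xs"
    using g unfolding recursive_def by blast
  obtain H where H: "recursive_functional (Suc (Suc k)) H"
      "\<And>\<omega> xs. length xs = Suc (Suc k) \<Longrightarrow> h \<omega> (xs ! 0) (xs ! 1) (drop 2 xs) = H \<omega> xs"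
    using h unfolding recursive_def by blast
  have "recursive (Suc k) (\<lambda>\<omega> xs. rec_nat (G \<omega> (tl xs)) (\<lambda>m r. H \<omega> (m # r # tl xs)) (hd xs))"
    using G(1) H(1) by (intro recursive_functional_imp_recursive recursive_functional.prim_rec)
  from recursive_push[OF this n] show ?thesis
  proof (rule recursive_cong)
    fix \<omega> :: point and xs :: "nat list" assume "length xs = k"
    then have "(\<lambda>m r. H \<omega> (m # r # xs)) = (\<lambda>m r. h \<omega> m r xs)" "G \<omega> xs = g \<omega> xs"
      using H(2)[of "_ # _ # xs" \<omega>] G(2) by auto
    then show "rec_nat (G \<omega> (tl (n \<omega> xs # xs))) (\<lambda>m r. H \<omega> (m # r # tl (n \<omega> xs # xs)))
        (hd (n \<omega> xs # xs)) = rec_nat (g \<omega> xs) (\<lambda>m r. h \<omega> m r xs) (n \<omega> xs)"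
      by simp
  qed
qed

section \<open>Arithmetic, decidable predicates and minimisation\<close>

lemma recursive_add:
  assumes "recursive k f" "recursive k g"
  shows "recursive k (\<lambda>\<omega> xs. f \<omega> xs + g \<omega> xs)"
proof -
  have "recursive k (\<lambda>\<omega> xs. rec_nat (f \<omega> xs) (\<lambda>m r. Suc r) (g \<omega> xs))"
    by (intro recursive_rec_nat assms recursive_Suc recursive_proj) simp
  moreover have "rec_nat x (\<lambda>m r. Suc r) y = x + y" for x y :: nat by (induction y) auto
  ultimately show ?thesis by simp
qed

lemma recursive_mult:
  assumes "recursive k f" "recursive k g"
  shows "recursive k (\<lambda>\<omega> xs. f \<omega> xs * g \<omega> xs)"
proof -
  have "recursive k (\<lambda>\<omega> xs. rec_nat 0 (\<lambda>m r. r + f \<omega> xs) (g \<omega> xs))"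
    by (intro recursive_rec_nat assms recursive_const recursive_add recursive_proj
        recursive_drop[OF assms(1)]) auto
  moreover have "rec_nat 0 (\<lambda>m r. r + x) y = x * y" for x y :: nat by (induction y) auto
  ultimately show ?thesis by simp
qed

lemma recursive_pred:
  assumes "recursive k f"
  shows "recursive k (\<lambda>\<omega> xs. f \<omega> xs - 1)"
proof -
  have "recursive k (\<lambda>\<omega> xs. rec_nat 0 (\<lambda>m r. m) (f \<omega> xs))"
    by (intro recursive_rec_nat assms recursive_const recursive_proj) auto
  moreover have "rec_nat 0 (\<lambda>m r. m) y = y - 1" for y :: nat by (induction y) auto
  ultimately show ?thesis by simp
qed

lemma recursive_diff:
  assumes "recursive k f" "recursive k g"
  shows "recursive k (\<lambda>\<omega> xs. f \<omega> xs - g \<omega> xs)"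
proof -
  have "recursive k (\<lambda>\<omega> xs. rec_nat (f \<omega> xs) (\<lambda>m r. r - 1) (g \<omega> xs))"
    by (intro recursive_rec_nat assms recursive_pred recursive_proj) auto
  moreover have "rec_nat x (\<lambda>m r. r - 1) y = x - y" for x y :: nat by (induction y) auto
  ultimately show ?thesis by simp
qed

lemma recursive_power:
  assumes "recursive k f" "recursive k g"
  shows "recursive k (\<lambda>\<omega> xs. f \<omega> xs ^ g \<omega> xs)"
proof -
  have "recursive k (\<lambda>\<omega> xs. rec_nat 1 (\<lambda>m r. r * f \<omega> xs) (g \<omega> xs))"
    by (intro recursive_rec_nat assms recursive_const recursive_mult recursive_proj
        recursive_drop[OF assms(1)]) auto
  moreover have "rec_nat 1 (\<lambda>m r. r * x) y = x ^ y" for x y :: nat by (induction y) auto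
  ultimately show ?thesis by simp
qed

lemma recursive_sum:
  assumes f: "recursive (Suc k) (\<lambda>\<omega> zs. f \<omega> (zs ! 0) (drop 1 zs))" and b: "recursive k b"
  shows "recursive k (\<lambda>\<omega> xs. \<Sum>y<b \<omega> xs. f \<omega> y xs)"
proof -
  have "recursive (Suc (Suc k)) (\<lambda>\<omega> zs. f \<omega> (zs ! 0) (drop 2 zs))"
    using recursive_skip[OF f, of "Suc (Suc k)" 2 0] by simp
  then have "recursive k (\<lambda>\<omega> xs. rec_nat 0 (\<lambda>m r. r + f \<omega> m xs) (b \<omega> xs))"
    by (intro recursive_rec_nat b recursive_const recursive_add recursive_proj) auto
  moreover have "rec_nat 0 (\<lambda>m r. r + F m) y = (\<Sum>i<y. F i)" for y :: nat and F :: "nat \<Rightarrow> nat"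
    by (induction y) auto
  ultimately show ?thesis by simp
qed

lemma recursive_sum_list:
  "(\<And>G. G \<in> set Gs \<Longrightarrow> recursive k (\<phi> G)) \<Longrightarrow>
    recursive k (\<lambda>\<omega> xs. \<Sum>G\<leftarrow>Gs. \<phi> G \<omega> xs)"
  by (induction Gs) (auto intro: recursive_const recursive_add)

lemma decidable_cong:
  assumes "decidable k P" "\<And>\<omega> xs. length xs = k \<Longrightarrow> P \<omega> xs = Q \<omega> xs"
  shows "decidable k Q"
  using assms(1) unfolding decidable_def by (rule recursive_cong) (simp add: assms(2))

lemma decidable_eq_0: "recursive k f \<Longrightarrow> decidable k (\<lambda>\<omega> xs. f \<omega> xs = 0)"
  unfolding decidable_def
  by (rule recursive_cong[OF recursive_diff[OF recursive_const[of k 1]], of f]) auto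

lemma recursive_of_bool: "decidable k P \<Longrightarrow> recursive k (\<lambda>\<omega> xs. of_bool (P \<omega> xs))"
  unfolding decidable_def .

lemma decidable_not: "decidable k P \<Longrightarrow> decidable k (\<lambda>\<omega> xs. \<not> P \<omega> xs)"
  using decidable_eq_0[OF recursive_of_bool, of k P] by simp

lemma decidable_conj: "decidable k P \<Longrightarrow> decidable k Q \<Longrightarrow> decidable k (\<lambda>\<omega> xs. P \<omega> xs \<and> Q \<omega> xs)"
  unfolding decidable_def of_bool_conj by (rule recursive_mult)

lemma decidable_disj: "decidable k P \<Longrightarrow> decidable k Q \<Longrightarrow> decidable k (\<lambda>\<omega> xs. P \<omega> xs \<or> Q \<omega> xs)"
  using decidable_not[OF decidable_conj[OF decidable_not decidable_not], of k P Q] by simp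

lemma decidable_le:
  "recursive k f \<Longrightarrow> recursive k g \<Longrightarrow> decidable k (\<lambda>\<omega> xs. f \<omega> xs \<le> g \<omega> xs)"
  using decidable_eq_0[OF recursive_diff, of k f g] by simp

lemma decidable_less:
  "recursive k f \<Longrightarrow> recursive k g \<Longrightarrow> decidable k (\<lambda>\<omega> xs. f \<omega> xs < g \<omega> xs)"
  using decidable_not[OF decidable_le, of k g f] by (simp add: not_le)

lemma decidable_eq:
  "recursive k f \<Longrightarrow> recursive k g \<Longrightarrow> decidable k (\<lambda>\<omega> xs. f \<omega> xs = g \<omega> xs)"
  using decidable_conj[OF decidable_le decidable_le, of k f g g f] by (simp add: eq_iff)

lemma decidable_query:
  "recursive k f \<Longrightarrow> recursive k g \<Longrightarrow> decidable k (\<lambda>\<omega> xs. \<omega> (f \<omega> xs) (g \<omega> xs))"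
  unfolding decidable_def by (rule recursive_query)

text \<open>The statement holds iff the number of counterexamples below the bound is zero.\<close>

lemma decidable_all_less:
  assumes P: "decidable (Suc k) (\<lambda>\<omega> zs. P \<omega> (zs ! 0) (drop 1 zs))" and b: "recursive k b"
  shows "decidable k (\<lambda>\<omega> xs. \<forall>y<b \<omega> xs. P \<omega> y xs)"
proof -
  have "decidable k (\<lambda>\<omega> xs. (\<Sum>y<b \<omega> xs. of_bool (\<not> P \<omega> y xs) :: nat) = 0)"
    by (intro decidable_eq_0 recursive_sum recursive_of_bool decidable_not P b)
  then show ?thesis by (auto elim!: decidable_cong)
qed

lemma recursive_if:
  assumes "decidable k P" "recursive k f" "recursive k g"
  shows "recursive k (\<lambda>\<omega> xs. if P \<omega> xs then f \<omega> xs else g \<omega> xs)"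
proof -
  have "recursive k (\<lambda>\<omega> xs. of_bool (P \<omega> xs) * f \<omega> xs + of_bool (\<not> P \<omega> xs) * g \<omega> xs)"
    by (intro recursive_add recursive_mult recursive_of_bool decidable_not assms)
  then show ?thesis by (rule recursive_cong) simp
qed

lemma decidable_if:
  assumes "decidable k P" "decidable k Q" "decidable k R"
  shows "decidable k (\<lambda>\<omega> xs. if P \<omega> xs then Q \<omega> xs else R \<omega> xs)"
proof -
  have "recursive k (\<lambda>\<omega> xs. if P \<omega> xs then of_bool (Q \<omega> xs) else of_bool (R \<omega> xs))"
    by (intro recursive_if recursive_of_bool assms)
  then show ?thesis unfolding decidable_def by (rule recursive_cong) simp
qed

lemma recursive_Least:
  assumes P: "decidable (Suc k) (\<lambda>\<omega> zs. P \<omega> (zs ! 0) (drop 1 zs))"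
    and ex: "\<And>\<omega> xs. length xs = k \<Longrightarrow> \<exists>y. P \<omega> y xs"
  shows "recursive k (\<lambda>\<omega> xs. LEAST y. P \<omega> y xs)"
proof -
  \<comment> \<open>Minimisation looks for a zero, hence the indicator of the negation.\<close>
  have "recursive (Suc k) (\<lambda>\<omega> zs. of_bool (\<not> P \<omega> (zs ! 0) (drop 1 zs)))"
    by (intro recursive_of_bool decidable_not P)
  then obtain F where F: "recursive_functional (Suc k) F"
     "\<And>\<omega> xs. length xs = Suc k \<Longrightarrow> of_bool (\<not> P \<omega> (xs ! 0) (drop 1 xs)) = F \<omega> xs"
    unfolding recursive_def by blast
  have *: "F \<omega> (y # xs) = 0 \<longleftrightarrow> P \<omega> y xs" if "length xs = k" for \<omega> y xs
    using F(2)[of "y # xs" \<omega>] that by (cases "P \<omega> y xs") auto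
  have "recursive k (\<lambda>\<omega> xs. LEAST y. F \<omega> (y # xs) = 0)"
    using * ex by (intro recursive_functional_imp_recursive recursive_functional.minimise F(1)) auto
  then show ?thesis by (rule recursive_cong) (simp add: *)
qed

lemma recursive_div:
  assumes "recursive k f" "recursive k g"
  shows "recursive k (\<lambda>\<omega> xs. f \<omega> xs div g \<omega> xs)"
proof -
  \<comment> \<open>The disjunct \<open>y = 0\<close> makes the search succeed at once for a zero
    divisor, in accordance with \<open>x div 0 = 0\<close>.\<close>
  have eq: "(LEAST q. y = 0 \<or> x < Suc q * y) = x div y" for x y :: nat
  proof (rule Least_equality)
    show "y = 0 \<or> x < Suc (x div y) * y"
      using dividend_less_div_times[of y x] by (cases "y = 0") auto
  next
    fix q assume "y = 0 \<or> x < Suc q * y"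
    then show "x div y \<le> q"
      by (metis div_by_0 le0 less_Suc_eq_le less_mult_imp_div_less)
  qed
  have "recursive k (\<lambda>\<omega> xs. LEAST q. g \<omega> xs = 0 \<or> f \<omega> xs < Suc q * g \<omega> xs)"
  proof (rule recursive_Least)
    show "decidable (Suc k) (\<lambda>\<omega> zs. g \<omega> (drop 1 zs) = 0 \<or>
        f \<omega> (drop 1 zs) < Suc (zs ! 0) * g \<omega> (drop 1 zs))"
      by (intro decidable_disj decidable_eq_0 decidable_less recursive_mult recursive_Suc
          recursive_proj recursive_drop[OF assms(1)] recursive_drop[OF assms(2)]) auto
    show "\<exists>q. g \<omega> xs = 0 \<or> f \<omega> xs < Suc q * g \<omega> xs" for \<omega> xs
      using dividend_less_div_times[of "g \<omega> xs" "f \<omega> xs"]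
      by (intro exI[of _ "f \<omega> xs div g \<omega> xs"]) auto
  qed
  then show ?thesis unfolding eq .
qed

lemma decidable_odd:
  assumes "recursive k f"
  shows "decidable k (\<lambda>\<omega> xs. odd (f \<omega> xs))"
proof -
  have "decidable k (\<lambda>\<omega> xs. f \<omega> xs - 2 * (f \<omega> xs div 2) = 1)"
    by (intro decidable_eq recursive_diff recursive_mult recursive_div recursive_const assms)
  then show ?thesis
    by (rule decidable_cong) (simp add: minus_mult_div_eq_mod odd_iff_mod_2_eq_one)
qed

lemmas recursive_intros =
  recursive_proj recursive_proj_drop recursive_proj_drop2 recursive_const recursive_Suc
  recursive_add recursive_mult recursive_diff recursive_power recursive_div recursive_if
  recursive_of_bool decidable_eq decidable_less decidable_le decidable_not decidable_conj
  decidable_disj decidable_odd decidable_query decidable_if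

section \<open>Replacing the oracle, and moduli of continuity\<close>

text \<open>Every query can be answered by computing \<open>T\<close> instead. The \<open>l\<close>
  parameters of \<open>T\<close> stand behind the arguments of \<open>F\<close>, so that variables
  bound during the induction can be pushed in front. Minimisation survives because its search
  succeeds for all oracles, in particular for \<open>T\<close>.\<close>

lemma recursive_oracle_subst:
  assumes F: "recursive_functional k F"
    and T: "decidable (Suc (Suc l)) (\<lambda>\<omega> zs. T \<omega> (drop 2 zs) (zs ! 0) (zs ! 1))"
  shows "recursive (k + l) (\<lambda>\<omega> zs. F (T \<omega> (drop k zs)) (take k zs))"
  using F
proof induction
  case (zero k)
  show ?case by (rule recursive_const)
next
  case succ
  show ?case by (rule recursive_cong[OF recursive_Suc[OF recursive_proj[of 0]]]) auto
next
  case (proj i k)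
  then show ?case by (intro recursive_cong[OF recursive_proj[of i]]) auto
next
  case query
  have "recursive (2 + l) (\<lambda>\<omega> zs. of_bool (T \<omega> (drop 2 zs) (zs ! 0) (zs ! 1)))"
    using T unfolding decidable_def by simp
  then show ?case by (rule recursive_cong) simp
next
  case (subst Gs F k)
  define g where "g = (\<lambda>\<omega> zs. map (\<lambda>G. G (T \<omega> (drop k zs)) (take k zs)) Gs @ drop k zs)"
  have "recursive (k + l) (\<lambda>\<omega> zs. F (T \<omega> (drop (length Gs) (g \<omega> zs))) (take (length Gs) (g \<omega> zs)))"
  proof (rule recursive_reindex[OF subst.IH(1)])
    fix i assume i: "i < length Gs + l"
    show "recursive (k + l) (\<lambda>\<omega> zs. g \<omega> zs ! i)"
    proof (cases "i < length Gs")
      case True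
      then have "recursive (k + l) (\<lambda>\<omega> zs. (Gs ! i) (T \<omega> (drop k zs)) (take k zs))"
        by (intro subst) auto
      then show ?thesis using True by (simp add: g_def nth_append)
    next
      case False
      then show ?thesis using i by (simp add: g_def nth_append recursive_proj_drop)
    qed
  qed (simp add: g_def)
  then show ?case by (simp add: g_def)
next
  case (prim_rec k G H)
  have 1: "recursive (Suc (k + l)) (\<lambda>\<omega> zs. G (T \<omega> (drop k (drop 1 zs))) (take k (drop 1 zs)))"
    using recursive_drop[OF prim_rec.IH(1), of "Suc (k + l)" 1] by simp
  \<comment> \<open>Position 2 holds the bound of the recursion, which \<open>H\<close> does not
    take as an argument.\<close>
  have "recursive (Suc (Suc (Suc (k + l)))) (\<lambda>\<omega> zs. H (T \<omega> (drop (Suc (Suc k)) (zs ! 0 # zs ! 1 # drop 3 zs)))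
      (take (Suc (Suc k)) (zs ! 0 # zs ! 1 # drop 3 zs)))"
  proof (rule recursive_reindex[OF prim_rec.IH(2)])
    fix i assume i: "i < Suc (Suc k) + l"
    consider "i = 0" | "i = 1" | j where "i = Suc (Suc j)"
      by (metis One_nat_def not0_implies_Suc)
    then show "recursive (Suc (Suc (Suc (k + l)))) (\<lambda>\<omega> xs. (xs ! 0 # xs ! 1 # drop 3 xs) ! i)"
      using i by cases (auto intro: recursive_intros)
  qed simp
  then have 2: "recursive (Suc (Suc (Suc (k + l)))) (\<lambda>\<omega> zs. H (T \<omega> (drop k (drop 1 (drop 2 zs))))
      (zs ! 0 # zs ! 1 # take k (drop 1 (drop 2 zs))))"
    by (simp add: eval_nat_numeral)
  have "recursive (Suc (k + l)) (\<lambda>\<omega> zs. rec_nat (G (T \<omega> (drop k (drop 1 zs))) (take k (drop 1 zs)))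
      (\<lambda>m r. H (T \<omega> (drop k (drop 1 zs))) (m # r # take k (drop 1 zs))) (zs ! 0))"
    by (intro recursive_rec_nat 1 2 recursive_proj) simp
  then have "recursive (Suc k + l) (\<lambda>\<omega> zs. rec_nat (G (T \<omega> (drop k (drop 1 zs))) (take k (drop 1 zs)))
      (\<lambda>m r. H (T \<omega> (drop k (drop 1 zs))) (m # r # take k (drop 1 zs))) (zs ! 0))"
    by simp
  then show ?case
    by (rule recursive_cong) (auto simp: length_Suc_conv)
next
  case (minimise k F)
  have "recursive (k + l) (\<lambda>\<omega> zs. LEAST y. F (T \<omega> (drop k zs)) (y # take k zs) = 0)"
  proof (rule recursive_Least)
    have "recursive (Suc (k + l)) (\<lambda>\<omega> zs. F (T \<omega> (drop k (drop 1 zs))) (zs ! 0 # take k (drop 1 zs)))"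
      by (rule recursive_cong[OF minimise.IH[simplified]]) (auto simp: length_Suc_conv)
    then show "decidable (Suc (k + l)) (\<lambda>\<omega> zs. F (T \<omega> (drop k (drop 1 zs))) (zs ! 0 # take k (drop 1 zs)) = 0)"
      by (rule decidable_eq_0)
  qed (use minimise in auto)
  then show ?case .
qed

text \<open>The step functions are compared only at values that the first recursion reaches; a
  modulus computed along that recursion controls just these.\<close>

lemma rec_nat_cong:
  fixes g g' :: nat
  assumes "g = g'" "\<And>i. i < n \<Longrightarrow> h i (rec_nat g h i) = h' i (rec_nat g h i)"
  shows "rec_nat g h n = rec_nat g' h' n"
  using assms(2)
proof (induction n)
  case (Suc n)
  then have "rec_nat g h n = rec_nat g' h' n" by auto
  then show ?case using Suc.prems[of n] by simp
qed (use assms in simp)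

text \<open>The modulus at \<omega> collects the moduli of all calls made in the evaluation at
  \<omega>. Only an upper bound matters, so sums replace maxima. Agreement up to this bound makes
  the evaluation at \<omega>' run through the same values.\<close>

lemma recursive_functional_modulus:
  assumes "recursive_functional k F"
  shows "\<exists>m. recursive k m \<and>
    (\<forall>\<omega> \<omega>' xs. length xs = k \<longrightarrow> agree (m \<omega> xs) \<omega> \<omega>' \<longrightarrow> F \<omega>' xs = F \<omega> xs)"
  using assms
proof induction
  case (zero k)
  show ?case using recursive_const by blast
next
  case succ
  show ?case using recursive_const by blast
next
  case (proj i k)
  show ?case using recursive_const by blast
next
  case query
  \<comment> \<open>The successor of the sum exceeds both coordinates of the queried bit.\<close>
  have "recursive 2 (\<lambda>\<omega> xs. Suc (xs ! 0 + xs ! 1))"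
    by (intro recursive_intros) auto
  then show ?case
    by (rule exI[of _ "\<lambda>\<omega> xs. Suc (xs ! 0 + xs ! 1)", OF conjI]) (auto simp: agree_def)
next
  case (subst Gs F k)
  obtain mF where mF: "recursive (length Gs) mF"
    "\<And>\<omega> \<omega>' xs. length xs = length Gs \<Longrightarrow> agree (mF \<omega> xs) \<omega> \<omega>' \<Longrightarrow> F \<omega>' xs = F \<omega> xs"
    using subst.IH(1) by blast
  obtain mG where mG: "\<And>G. G \<in> set Gs \<Longrightarrow> recursive k (mG G)"
    "\<And>G \<omega> \<omega>' xs. G \<in> set Gs \<Longrightarrow> length xs = k \<Longrightarrow> agree (mG G \<omega> xs) \<omega> \<omega>' \<Longrightarrow> G \<omega>' xs = G \<omega> xs"
    using subst.IH(2) by metis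
  let ?m = "\<lambda>\<omega> xs. mF \<omega> (map (\<lambda>G. G \<omega> xs) Gs) + (\<Sum>G\<leftarrow>Gs. mG G \<omega> xs)"
  have "recursive k ?m"
    using subst.hyps(2) by (intro recursive_add recursive_sum_list recursive_subst mF mG
        recursive_functional_imp_recursive) auto
  moreover have "F \<omega>' (map (\<lambda>G. G \<omega>' xs) Gs) = F \<omega> (map (\<lambda>G. G \<omega> xs) Gs)"
    if len: "length xs = k" and ag: "agree (?m \<omega> xs) \<omega> \<omega>'" for \<omega> \<omega>' xs
  proof -
    have "G \<omega>' xs = G \<omega> xs" if G: "G \<in> set Gs" for G
    proof -
      have "mG G \<omega> xs \<le> (\<Sum>G\<leftarrow>Gs. mG G \<omega> xs)"
        using G by (intro member_le_sum_list) auto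
      then have "agree (mG G \<omega> xs) \<omega> \<omega>'"
        by (intro agree_mono[OF ag]) simp
      then show ?thesis using mG(2)[OF G len] by simp
    qed
    then have "map (\<lambda>G. G \<omega>' xs) Gs = map (\<lambda>G. G \<omega> xs) Gs" by simp
    moreover have "agree (mF \<omega> (map (\<lambda>G. G \<omega> xs) Gs)) \<omega> \<omega>'"
      by (intro agree_mono[OF ag]) simp
    ultimately show ?thesis by (metis mF(2) length_map)
  qed
  ultimately show ?case by blast
next
  case (prim_rec k G H)
  obtain mG where mG: "recursive k mG"
    "\<And>\<omega> \<omega>' xs. length xs = k \<Longrightarrow> agree (mG \<omega> xs) \<omega> \<omega>' \<Longrightarrow> G \<omega>' xs = G \<omega> xs"
    using prim_rec.IH(1) by blast
  obtain mH where mH: "recursive (Suc (Suc k)) mH"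
    "\<And>\<omega> \<omega>' xs. length xs = Suc (Suc k) \<Longrightarrow> agree (mH \<omega> xs) \<omega> \<omega>' \<Longrightarrow> H \<omega>' xs = H \<omega> xs"
    using prim_rec.IH(2) by blast
  let ?R = "\<lambda>\<omega> n xs. rec_nat (G \<omega> xs) (\<lambda>m r. H \<omega> (m # r # xs)) n"
  \<comment> \<open>The moduli of \<open>H\<close> are taken at the intermediate values of the
    recursion with oracle \<omega>.\<close>
  let ?m = "\<lambda>\<omega> zs. mG \<omega> (drop 1 zs) + (\<Sum>i<zs ! 0. mH \<omega> (i # ?R \<omega> i (drop 1 zs) # drop 1 zs))"
  have R: "recursive (Suc k) (\<lambda>\<omega> xs. ?R \<omega> (hd xs) (tl xs))"
    using prim_rec.hyps by (intro recursive_functional_imp_recursive recursive_functional.prim_rec)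
  have R': "recursive (Suc (Suc k)) (\<lambda>\<omega> zs. ?R \<omega> (zs ! 0) (drop 2 zs))"
    using recursive_skip[OF R, of "Suc (Suc k)" 2 0] by simp
  have R'': "recursive (Suc (Suc k)) (\<lambda>\<omega> zs. mH \<omega> (zs ! 0 # ?R \<omega> (zs ! 0) (drop 2 zs) # drop 2 zs))"
  proof (rule recursive_reindex[OF mH(1)])
    fix i assume i: "i < Suc (Suc k)"
    consider "i = 0" | "i = 1" | j where "i = Suc (Suc j)"
      by (metis One_nat_def not0_implies_Suc)
    then show "recursive (Suc (Suc k)) (\<lambda>\<omega> zs. (zs ! 0 # ?R \<omega> (zs ! 0) (drop 2 zs) # drop 2 zs) ! i)"
      using i R' by cases (auto intro: recursive_intros)
  qed simp
  have "recursive (Suc k) ?m"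
    using R'' by (intro recursive_add recursive_sum recursive_drop[OF mG(1)] recursive_proj)
      (auto simp: numeral_2_eq_2)
  moreover have "?R \<omega>' (hd zs) (tl zs) = ?R \<omega> (hd zs) (tl zs)"
    if len: "length zs = Suc k" and ag: "agree (?m \<omega> zs) \<omega> \<omega>'" for \<omega> \<omega>' zs
  proof -
    obtain n xs where zs: "zs = n # xs" "length xs = k" using len by (auto simp: length_Suc_conv)
    have "?R \<omega> n xs = ?R \<omega>' n xs"
    proof (rule rec_nat_cong)
      show "G \<omega> xs = G \<omega>' xs"
        using zs by (intro mG(2)[symmetric] agree_mono[OF ag]) simp_all
      fix i assume "i < n"
      then have "mH \<omega> (i # ?R \<omega> i xs # xs) \<le> (\<Sum>i<n. mH \<omega> (i # ?R \<omega> i xs # xs))"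
        by (intro member_le_sum) auto
      then show "H \<omega> (i # ?R \<omega> i xs # xs) = H \<omega>' (i # ?R \<omega> i xs # xs)"
        using zs by (intro mH(2)[symmetric] agree_mono[OF ag]) simp_all
    qed
    then show ?thesis using zs by simp
  qed
  ultimately show ?case by blast
next
  case (minimise k F)
  obtain mF where mF: "recursive (Suc k) mF"
    "\<And>\<omega> \<omega>' xs. length xs = Suc k \<Longrightarrow> agree (mF \<omega> xs) \<omega> \<omega>' \<Longrightarrow> F \<omega>' xs = F \<omega> xs"
    using minimise.IH by blast
  let ?L = "\<lambda>\<omega> xs. LEAST y. F \<omega> (y # xs) = 0"
  \<comment> \<open>The \<open>Suc\<close> includes the least zero itself: agreement must preserve
    the zero as well as the nonzero values before it.\<close>
  let ?m = "\<lambda>\<omega> xs. \<Sum>y<Suc (?L \<omega> xs). mF \<omega> (y # xs)"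
  have "recursive (Suc k) (\<lambda>\<omega> zs. mF \<omega> (zs ! 0 # drop 1 zs))"
    using recursive_skip[OF mF(1), of "Suc k" 1 0] by simp
  moreover have "recursive k ?L"
    using minimise.hyps by (intro recursive_functional_imp_recursive recursive_functional.minimise)
  ultimately have "recursive k ?m"
    by (intro recursive_sum recursive_Suc)
  moreover have "?L \<omega>' xs = ?L \<omega> xs"
    if len: "length xs = k" and ag: "agree (?m \<omega> xs) \<omega> \<omega>'" for \<omega> \<omega>' xs
  proof -
    have eq: "F \<omega>' (y # xs) = F \<omega> (y # xs)" if "y \<le> ?L \<omega> xs" for y
    proof (rule mF(2))
      have "mF \<omega> (y # xs) \<le> ?m \<omega> xs"
        using that by (intro member_le_sum) auto
      then show "agree (mF \<omega> (y # xs)) \<omega> \<omega>'" using ag agree_mono by blast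
    qed (use len in simp)
    have "F \<omega> (?L \<omega> xs # xs) = 0"
      using minimise.hyps(2)[OF len, of \<omega>] by (rule LeastI_ex)
    then show ?thesis
    proof (intro Least_equality)
      fix y assume y: "F \<omega>' (y # xs) = 0"
      show "?L \<omega> xs \<le> y"
      proof (rule ccontr)
        assume "\<not> ?L \<omega> xs \<le> y"
        then have "F \<omega> (y # xs) = 0" "y < ?L \<omega> xs" using eq[of y] y by auto
        then show False using not_less_Least by blast
      qed
    qed (simp add: eq)
  qed
  ultimately show ?case by blast
qed

lemma recursive_modulus:
  assumes "recursive k f"
  obtains m where "recursive k m"
    "\<And>\<omega> \<omega>' xs. length xs = k \<Longrightarrow> agree (m \<omega> xs) \<omega> \<omega>' \<Longrightarrow> f \<omega>' xs = f \<omega> xs"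
proof -
  obtain F where F: "recursive_functional k F" "\<And>\<omega> xs. length xs = k \<Longrightarrow> f \<omega> xs = F \<omega> xs"
    using assms unfolding recursive_def by blast
  then show ?thesis using recursive_functional_modulus[OF F(1)] that by metis
qed

text \<open>The modulus depends on the point; compactness turns it into a uniform bound.\<close>

lemma finitely_determined_recursive:
  assumes "recursive k f" "length xs = k"
  shows "finitely_determined (\<lambda>\<omega>. f \<omega> xs)"
proof -
  obtain m where "\<And>\<omega> \<omega>' xs. length xs = k \<Longrightarrow> agree (m \<omega> xs) \<omega> \<omega>' \<Longrightarrow> f \<omega>' xs = f \<omega> xs"
    using recursive_modulus[OF assms(1)] by metis
  then show ?thesis
    using assms(2) by (intro finitely_determined_of_modulus[of "\<lambda>\<omega>. m \<omega> xs"]) auto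
qed

section \<open>Recursive rational-valued functionals\<close>

definition recursive_rat :: "nat \<Rightarrow> (point \<Rightarrow> nat list \<Rightarrow> rat) \<Rightarrow> bool" where
  "recursive_rat k q \<longleftrightarrow>
     (\<exists>g. recursive k g \<and> (\<forall>\<omega> xs. length xs = k \<longrightarrow> q \<omega> xs = rat_enum (g \<omega> xs)))"

lemma recursive_triangle: "recursive k f \<Longrightarrow> recursive k (\<lambda>\<omega> xs. triangle (f \<omega> xs))"
  unfolding triangle_def by (intro recursive_intros)

lemma recursive_prod_encode:
  "recursive k f \<Longrightarrow> recursive k g \<Longrightarrow> recursive k (\<lambda>\<omega> xs. prod_encode (f \<omega> xs, g \<omega> xs))"
  unfolding prod_encode_def by (auto intro!: recursive_triangle recursive_intros)

text \<open>Both components of a pair are at most its code, so one is found by minimisation and the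
  other is quantified up to the code. The double negation expresses the bounded existential
  quantifier by the universal one.\<close>

lemma recursive_prod_decode:
  assumes "recursive k f"
  shows "recursive k (\<lambda>\<omega> xs. fst (prod_decode (f \<omega> xs)))"
    and "recursive k (\<lambda>\<omega> xs. snd (prod_decode (f \<omega> xs)))"
proof -
  have fst: "(LEAST a. \<not> (\<forall>b<Suc i. prod_encode (a, b) \<noteq> i)) = fst (prod_decode i)" for i
  proof (rule Least_equality)
    show "\<not> (\<forall>b<Suc i. prod_encode (fst (prod_decode i), b) \<noteq> i)"
      using le_prod_encode_2[of "snd (prod_decode i)" "fst (prod_decode i)"]
      by (auto intro!: exI[of _ "snd (prod_decode i)"])
  qed (metis eq_imp_le fst_conv prod_encode_inverse)
  have snd: "(LEAST b. \<not> (\<forall>a<Suc i. prod_encode (a, b) \<noteq> i)) = snd (prod_decode i)" for i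
  proof (rule Least_equality)
    show "\<not> (\<forall>a<Suc i. prod_encode (a, snd (prod_decode i)) \<noteq> i)"
      using le_prod_encode_1[of "fst (prod_decode i)" "snd (prod_decode i)"]
      by (auto intro!: exI[of _ "fst (prod_decode i)"])
  qed (metis eq_imp_le snd_conv prod_encode_inverse)
  have f1: "recursive (Suc k) (\<lambda>\<omega> zs. f \<omega> (drop 1 zs))"
    and f2: "recursive (Suc (Suc k)) (\<lambda>\<omega> zs. f \<omega> (drop 1 (drop 1 zs)))"
    using recursive_drop[OF assms, of "Suc (Suc k)" 2] recursive_drop[OF assms, of "Suc k" 1]
    by (simp_all add: numeral_2_eq_2)
  have "recursive k (\<lambda>\<omega> xs. LEAST a. \<not> (\<forall>b<Suc (f \<omega> xs). prod_encode (a, b) \<noteq> f \<omega> xs))"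
  proof (rule recursive_Least)
    show "decidable (Suc k) (\<lambda>\<omega> zs. \<not> (\<forall>b<Suc (f \<omega> (drop 1 zs)).
        prod_encode (zs ! 0, b) \<noteq> f \<omega> (drop 1 zs)))"
      by (intro decidable_not decidable_all_less decidable_eq recursive_prod_encode f1 f2 recursive_intros)
        auto
    show "\<exists>y. \<not> (\<forall>b<Suc (f \<omega> xs). prod_encode (y, b) \<noteq> f \<omega> xs)" for \<omega> xs
      using le_prod_encode_2[of "snd (prod_decode (f \<omega> xs))" "fst (prod_decode (f \<omega> xs))"]
      by (intro exI[of _ "fst (prod_decode (f \<omega> xs))"]) (auto intro!: exI[of _ "snd (prod_decode (f \<omega> xs))"])
  qed
  then show "recursive k (\<lambda>\<omega> xs. fst (prod_decode (f \<omega> xs)))" unfolding fst .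
  have "recursive k (\<lambda>\<omega> xs. LEAST b. \<not> (\<forall>a<Suc (f \<omega> xs). prod_encode (a, b) \<noteq> f \<omega> xs))"
  proof (rule recursive_Least)
    show "decidable (Suc k) (\<lambda>\<omega> zs. \<not> (\<forall>a<Suc (f \<omega> (drop 1 zs)).
        prod_encode (a, zs ! 0) \<noteq> f \<omega> (drop 1 zs)))"
      by (intro decidable_not decidable_all_less decidable_eq recursive_prod_encode f1 f2 recursive_intros)
        auto
    show "\<exists>y. \<not> (\<forall>a<Suc (f \<omega> xs). prod_encode (a, y) \<noteq> f \<omega> xs)" for \<omega> xs
      using le_prod_encode_1[of "fst (prod_decode (f \<omega> xs))" "snd (prod_decode (f \<omega> xs))"]
      by (intro exI[of _ "snd (prod_decode (f \<omega> xs))"]) (auto intro!: exI[of _ "fst (prod_decode (f \<omega> xs))"])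
  qed
  then show "recursive k (\<lambda>\<omega> xs. snd (prod_decode (f \<omega> xs)))" unfolding snd .
qed

text \<open>A difference of natural numbers stands for the signed numerator and \<open>Suc\<close>
  keeps the denominator nonzero. Fractions in this form need not be reduced, so rational arithmetic
  becomes arithmetic of natural numbers.\<close>

lemma recursive_ratE:
  assumes "recursive_rat k q"
  obtains p n d where "recursive k p" "recursive k n" "recursive k d"
    "\<And>\<omega> xs. length xs = k \<Longrightarrow>
       q \<omega> xs = (of_nat (p \<omega> xs) - of_nat (n \<omega> xs)) / of_nat (Suc (d \<omega> xs))"
proof -
  obtain g where g: "recursive k g" "\<And>\<omega> xs. length xs = k \<Longrightarrow> q \<omega> xs = rat_enum (g \<omega> xs)"
    using assms unfolding recursive_rat_def by blast
  let ?a = "\<lambda>i. fst (prod_decode i)"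
  \<comment> \<open>\<open>int_decode\<close> sends \<open>2 * m\<close> to \<open>m\<close> and
    \<open>2 * m + 1\<close> to \<open>- m - 1\<close>.\<close>
  let ?p = "\<lambda>i. if odd (?a i) then 0 else ?a i div 2"
  let ?n = "\<lambda>i. if odd (?a i) then Suc (?a i div 2) else 0"
  have *: "rat_enum i = (of_nat (?p i) - of_nat (?n i)) / of_nat (Suc (snd (prod_decode i)))" for i
    by (cases "prod_decode i") (auto simp: rat_enum_def int_decode_def sum_decode_def)
  show ?thesis
  proof (rule that)
    show "recursive k (\<lambda>\<omega> xs. ?p (g \<omega> xs))" "recursive k (\<lambda>\<omega> xs. ?n (g \<omega> xs))"
      "recursive k (\<lambda>\<omega> xs. snd (prod_decode (g \<omega> xs)))"
      by (intro recursive_prod_decode g recursive_intros)+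
  qed (simp add: g *)
qed

lemma recursive_ratI:
  assumes "recursive k p" "recursive k n" "recursive k d"
    "\<And>\<omega> xs. length xs = k \<Longrightarrow>
       q \<omega> xs = (of_nat (p \<omega> xs) - of_nat (n \<omega> xs)) / of_nat (Suc (d \<omega> xs))"
  shows "recursive_rat k q"
proof -
  \<comment> \<open>The second branch encodes the negative integer
    \<open>p - n = - (n - Suc p) - 1\<close> by an odd number.\<close>
  let ?g = "\<lambda>p n d. prod_encode (if n \<le> p then 2 * (p - n) else 2 * (n - Suc p) + 1, d)"
  have eq: "rat_enum (?g a b c) = (of_nat a - of_nat b) / of_nat (Suc c)" for a b c
    by (auto simp: rat_enum_def int_decode_def sum_decode_def of_nat_diff Suc_le_eq)
  have "recursive k (\<lambda>\<omega> xs. ?g (p \<omega> xs) (n \<omega> xs) (d \<omega> xs))"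
    by (intro recursive_prod_encode recursive_intros assms)
  then show ?thesis
    unfolding recursive_rat_def
    by (intro exI[of _ "\<lambda>\<omega> xs. ?g (p \<omega> xs) (n \<omega> xs) (d \<omega> xs)"] conjI allI impI)
      (assumption, simp only: eq assms(4))
qed

lemma recursive_rat_enum: "recursive k f \<Longrightarrow> recursive_rat k (\<lambda>\<omega> xs. rat_enum (f \<omega> xs))"
  unfolding recursive_rat_def by blast

lemma recursive_rat_const: "recursive_rat k (\<lambda>\<omega> xs. c)"
proof -
  obtain i where "c = rat_enum i" using surjD[OF surj_rat_enum] by blast
  then show ?thesis using recursive_rat_enum[OF recursive_const[of k i]] by simp
qed

lemma recursive_rat_add:
  assumes "recursive_rat k q" "recursive_rat k q'"
  shows "recursive_rat k (\<lambda>\<omega> xs. q \<omega> xs + q' \<omega> xs)"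
proof -
  obtain p n d where 1: "recursive k p" "recursive k n" "recursive k d"
    "\<And>\<omega> xs. length xs = k \<Longrightarrow>
       q \<omega> xs = (of_nat (p \<omega> xs) - of_nat (n \<omega> xs)) / of_nat (Suc (d \<omega> xs))"
    using recursive_ratE[OF assms(1)] by blast
  obtain p' n' d' where 2: "recursive k p'" "recursive k n'" "recursive k d'"
    "\<And>\<omega> xs. length xs = k \<Longrightarrow>
       q' \<omega> xs = (of_nat (p' \<omega> xs) - of_nat (n' \<omega> xs)) / of_nat (Suc (d' \<omega> xs))"
    using recursive_ratE[OF assms(2)] by blast
  \<comment> \<open>A denominator is stored less one, hence the \<open>- 1\<close> that undoes the
    outer \<open>Suc\<close>.\<close>
  have 3: "(of_nat a - of_nat b) / of_nat (Suc c) + (of_nat a' - of_nat b') / of_nat (Suc c') =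
     (of_nat (a * Suc c' + a' * Suc c) - of_nat (b * Suc c' + b' * Suc c)) /
       (of_nat (Suc (Suc c * Suc c' - 1)) :: rat)" for a b c a' b' c'
  proof -
    have "Suc (Suc c * Suc c' - 1) = Suc c * Suc c'" by simp
    moreover have "(of_nat (Suc c) :: rat) \<noteq> 0" "(of_nat (Suc c') :: rat) \<noteq> 0" by simp_all
    ultimately show ?thesis
      by (simp only: of_nat_mult of_nat_add) (simp add: add_frac_eq algebra_simps del: of_nat_Suc)
  qed
  show ?thesis
    by (rule recursive_ratI[where p = "\<lambda>\<omega> xs. p \<omega> xs * Suc (d' \<omega> xs) + p' \<omega> xs * Suc (d \<omega> xs)"
          and n = "\<lambda>\<omega> xs. n \<omega> xs * Suc (d' \<omega> xs) + n' \<omega> xs * Suc (d \<omega> xs)"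
          and d = "\<lambda>\<omega> xs. Suc (d \<omega> xs) * Suc (d' \<omega> xs) - 1"])
      (intro recursive_intros 1 2, intro recursive_intros 1 2, intro recursive_intros 1 2,
        simp only: 1(4) 2(4) 3)
qed

lemma recursive_rat_mult:
  assumes "recursive_rat k q" "recursive_rat k q'"
  shows "recursive_rat k (\<lambda>\<omega> xs. q \<omega> xs * q' \<omega> xs)"
proof -
  obtain p n d where 1: "recursive k p" "recursive k n" "recursive k d"
    "\<And>\<omega> xs. length xs = k \<Longrightarrow>
       q \<omega> xs = (of_nat (p \<omega> xs) - of_nat (n \<omega> xs)) / of_nat (Suc (d \<omega> xs))"
    using recursive_ratE[OF assms(1)] by blast
  obtain p' n' d' where 2: "recursive k p'" "recursive k n'" "recursive k d'"
    "\<And>\<omega> xs. length xs = k \<Longrightarrow>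
       q' \<omega> xs = (of_nat (p' \<omega> xs) - of_nat (n' \<omega> xs)) / of_nat (Suc (d' \<omega> xs))"
    using recursive_ratE[OF assms(2)] by blast
  have 3: "(of_nat a - of_nat b) / of_nat (Suc c) * ((of_nat a' - of_nat b') / of_nat (Suc c')) =
     (of_nat (a * a' + b * b') - of_nat (a * b' + b * a')) /
       (of_nat (Suc (Suc c * Suc c' - 1)) :: rat)" for a b c a' b' c'
  proof -
    have "Suc (Suc c * Suc c' - 1) = Suc c * Suc c'" by simp
    then show ?thesis
      by (simp only: of_nat_mult of_nat_add times_divide_times_eq) (simp only: algebra_simps)
  qed
  show ?thesis
    by (rule recursive_ratI[where p = "\<lambda>\<omega> xs. p \<omega> xs * p' \<omega> xs + n \<omega> xs * n' \<omega> xs"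
          and n = "\<lambda>\<omega> xs. p \<omega> xs * n' \<omega> xs + n \<omega> xs * p' \<omega> xs"
          and d = "\<lambda>\<omega> xs. Suc (d \<omega> xs) * Suc (d' \<omega> xs) - 1"])
      (intro recursive_intros 1 2, intro recursive_intros 1 2, intro recursive_intros 1 2,
        simp only: 1(4) 2(4) 3)
qed

lemma recursive_rat_diff:
  assumes "recursive_rat k q" "recursive_rat k q'"
  shows "recursive_rat k (\<lambda>\<omega> xs. q \<omega> xs - q' \<omega> xs)"
  using recursive_rat_add[OF assms(1) recursive_rat_mult[OF recursive_rat_const[of k "-1"] assms(2)]]
  by simp

lemma recursive_rat_of_nat: "recursive k f \<Longrightarrow> recursive_rat k (\<lambda>\<omega> xs. of_nat (f \<omega> xs))"
  by (rule recursive_ratI[of k f "\<lambda>_ _. 0" "\<lambda>_ _. 0"]) (auto intro: recursive_const)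

lemma recursive_rat_inverse_of_nat:
  assumes "recursive k f"
  shows "recursive_rat k (\<lambda>\<omega> xs. 1 / of_nat (f \<omega> xs))"
  \<comment> \<open>The numerator is 0 where \<open>f\<close> vanishes, to match
    \<open>1 / 0 = 0\<close>.\<close>
  by (rule recursive_ratI[of k "\<lambda>\<omega> xs. of_bool (f \<omega> xs \<noteq> 0)" "\<lambda>_ _. 0" "\<lambda>\<omega> xs. f \<omega> xs - 1"])
    (auto intro!: recursive_intros assms simp: of_nat_diff)

text \<open>The sign of a difference is that of its numerator. The trading strategy rests on this
  test, which has no counterpart for computable reals.\<close>

lemma decidable_rat_less:
  assumes "recursive_rat k q" "recursive_rat k q'"
  shows "decidable k (\<lambda>\<omega> xs. q \<omega> xs < q' \<omega> xs)"
proof -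
  obtain p n d where 1: "recursive k p" "recursive k n" "recursive k d"
    "\<And>\<omega> xs. length xs = k \<Longrightarrow>
       q' \<omega> xs - q \<omega> xs = (of_nat (p \<omega> xs) - of_nat (n \<omega> xs)) / of_nat (Suc (d \<omega> xs))"
    using recursive_ratE[OF recursive_rat_diff[OF assms(2,1)]] by blast
  have "n \<omega> xs < p \<omega> xs \<longleftrightarrow> q \<omega> xs < q' \<omega> xs" if "length xs = k" for \<omega> xs
  proof -
    have "q \<omega> xs < q' \<omega> xs \<longleftrightarrow> 0 < q' \<omega> xs - q \<omega> xs" by simp
    also have "\<dots> \<longleftrightarrow> n \<omega> xs < p \<omega> xs"
      unfolding 1(4)[OF that] by (simp add: zero_less_divide_iff del: of_nat_Suc)
    finally show ?thesis ..
  qed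
  then show ?thesis using decidable_less[OF 1(2,1)] by (rule decidable_cong[rotated])
qed

lemma recursive_rat_comp1:
  assumes "recursive_rat 1 q" "recursive k f"
  shows "recursive_rat k (\<lambda>\<omega> xs. q \<omega> [f \<omega> xs])"
proof -
  obtain g where g: "recursive 1 g" "\<And>\<omega> xs. length xs = 1 \<Longrightarrow> q \<omega> xs = rat_enum (g \<omega> xs)"
    using assms(1) unfolding recursive_rat_def by blast
  then show ?thesis using recursive_rat_enum[OF recursive_comp1[OF g(1) assms(2)]] by simp
qed

text \<open>The recursion runs on codes. A rational has many codes, so it agrees with the partial
  sums only after decoding by \<open>rat_enum\<close>.\<close>

lemma recursive_rat_sum:
  assumes f: "recursive_rat (Suc k) (\<lambda>\<omega> zs. f \<omega> (zs ! 0) (drop 1 zs))" and b: "recursive k b"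
  shows "recursive_rat k (\<lambda>\<omega> xs. \<Sum>y<b \<omega> xs. f \<omega> y xs)"
proof -
  obtain g where g: "recursive (Suc k) g"
    "\<And>\<omega> zs. length zs = Suc k \<Longrightarrow> f \<omega> (zs ! 0) (drop 1 zs) = rat_enum (g \<omega> zs)"
    using f unfolding recursive_rat_def by blast
  have "recursive_rat (Suc (Suc k)) (\<lambda>\<omega> zs. rat_enum (zs ! 1) + rat_enum (g \<omega> (zs ! 0 # drop 2 zs)))"
    by (intro recursive_rat_add recursive_rat_enum recursive_proj recursive_skip[OF g(1)]) auto
  then obtain h where h: "recursive (Suc (Suc k)) h" "\<And>\<omega> zs. length zs = Suc (Suc k) \<Longrightarrow>
      rat_enum (zs ! 1) + rat_enum (g \<omega> (zs ! 0 # drop 2 zs)) = rat_enum (h \<omega> zs)"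
    unfolding recursive_rat_def by blast
  obtain z where z: "rat_enum z = 0" using surjD[OF surj_rat_enum, of 0] by auto
  let ?R = "\<lambda>\<omega> xs. rec_nat z (\<lambda>m r. h \<omega> (m # r # xs))"
  have "recursive (Suc (Suc k)) (\<lambda>\<omega> zs. h \<omega> (zs ! 0 # zs ! 1 # drop 2 zs))"
    by (rule recursive_cong[OF h(1)]) (auto simp: length_Suc_conv)
  then have "recursive k (\<lambda>\<omega> xs. ?R \<omega> xs (b \<omega> xs))"
    by (intro recursive_rec_nat recursive_const b)
  moreover have eq: "rat_enum (?R \<omega> xs n) = (\<Sum>y<n. f \<omega> y xs)" if "length xs = k" for \<omega> xs n
  proof (induction n)
    case (Suc n)
    have "rat_enum (?R \<omega> xs (Suc n)) = rat_enum (?R \<omega> xs n) + rat_enum (g \<omega> (n # xs))"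
      using h(2)[of "n # ?R \<omega> xs n # xs" \<omega>] that by simp
    then show ?case using Suc g(2)[of "n # xs" \<omega>] that by simp
  qed (simp add: z)
  ultimately show ?thesis
    unfolding recursive_rat_def by (intro exI[of _ "\<lambda>\<omega> xs. ?R \<omega> xs (b \<omega> xs)"]) simp
qed

section \<open>Averaging over one row\<close>

text \<open>\<open>s\<close> encodes row \<open>n\<close> by its binary digits; all later rows vanish.\<close>

definition finite_oracle :: "nat \<Rightarrow> nat \<Rightarrow> point \<Rightarrow> point" where
  "finite_oracle n s \<omega> = (\<lambda>i j. if i < n then \<omega> i j else i = n \<and> bit s j)"

lemma comb_seq_False_eq_finite_oracle: "comb_seq n \<omega> (\<lambda>_ _. False) = finite_oracle n 0 \<omega>"
  by (auto simp: comb_seq_def finite_oracle_def fun_eq_iff)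

text \<open>An oracle substitution with \<open>n\<close> and \<open>s\<close> as parameters; bit
  \<open>j\<close> of \<open>s\<close> is the parity of \<open>s div 2 ^ j\<close>.\<close>

lemma recursive_finite_oracle:
  assumes "recursive 2 f" and args: "recursive k a" "recursive k b" "recursive k n" "recursive k s"
  shows "recursive k (\<lambda>\<omega> xs. f (finite_oracle (n \<omega> xs) (s \<omega> xs) \<omega>) [a \<omega> xs, b \<omega> xs])"
proof -
  obtain F where F: "recursive_functional 2 F" "\<And>\<omega> xs. length xs = 2 \<Longrightarrow> f \<omega> xs = F \<omega> xs"
    using assms(1) unfolding recursive_def by blast
  define T where "T \<omega> ys i j = (if i < ys ! 0 then \<omega> i j else i = ys ! 0 \<and> odd (ys ! 1 div 2 ^ j))"
    for \<omega> :: point and ys :: "nat list" and i j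
  have T: "T \<omega> [m, t] = finite_oracle m t \<omega>" for \<omega> m t
    by (simp add: T_def finite_oracle_def bit_iff_odd fun_eq_iff)
  have "recursive (2 + 2) (\<lambda>\<omega> zs. F (T \<omega> (drop 2 zs)) (take 2 zs))"
    by (rule recursive_oracle_subst[OF F(1)]) (unfold T_def, intro recursive_intros, auto)
  then have "recursive 4 (\<lambda>\<omega> zs. F (T \<omega> (drop 2 zs)) (take 2 zs))" by simp
  then have "recursive k (\<lambda>\<omega> xs. F (T \<omega> (drop 2 [a \<omega> xs, b \<omega> xs, n \<omega> xs, s \<omega> xs]))
      (take 2 [a \<omega> xs, b \<omega> xs, n \<omega> xs, s \<omega> xs]))"
  proof (rule recursive_reindex)
    fix i :: nat assume "i < 4"
    then consider "i = 0" | "i = 1" | "i = 2" | "i = 3" by linarith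
    then show "recursive k (\<lambda>\<omega> xs. [a \<omega> xs, b \<omega> xs, n \<omega> xs, s \<omega> xs] ! i)"
      using args by cases (auto simp: numeral_3_eq_3)
  qed simp
  then show ?thesis by (simp add: T F)
qed

text \<open>
  Only row \<open>n\<close> of the point has to be averaged over. A number \<open>N\<close> of bits of this row that determines
  the integrand is found by search: if a modulus \<open>m\<close> is at most \<open>N\<close> at each of the \<open>2 ^ N\<close> rows vanishing
  from bit \<open>N\<close> on, then \<open>N\<close> bits suffice for all rows. Compactness bounds \<open>m\<close>, so the search ends.
\<close>

lemma recursive_cond_E:
  assumes f: "recursive 2 f"
  obtains q where "recursive_rat 1 q"
    "\<And>n \<omega>. cond_E n (\<lambda>\<omega>. of_rat (rat_enum (f (comb_seq (Suc n) \<omega> (\<lambda>_ _. False)) [Suc n, Suc n]))) \<omega>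
       = of_rat (q \<omega> [n])"
proof -
  obtain m where m: "recursive 2 m"
    "\<And>\<omega> \<omega>' xs. length xs = 2 \<Longrightarrow> agree (m \<omega> xs) \<omega> \<omega>' \<Longrightarrow> f \<omega>' xs = f \<omega> xs"
    using recursive_modulus[OF f] by blast
  let ?P = "\<lambda>\<omega> N n. \<forall>s<2 ^ N. m (finite_oracle n s \<omega>) [Suc n, Suc n] \<le> N"
  have ex: "\<exists>N. ?P \<omega> N n" for \<omega> n
  proof -
    have "finite (range (\<lambda>\<omega>. m \<omega> [Suc n, Suc n]))"
      by (intro finite_range_finitely_determined finitely_determined_recursive[OF m(1)]) simp
    then have "m \<omega> [Suc n, Suc n] \<le> Max (range (\<lambda>\<omega>. m \<omega> [Suc n, Suc n]))" for \<omega>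
      by (intro Max_ge) auto
    then show ?thesis by blast
  qed
  define N where "N \<omega> n = (LEAST N. ?P \<omega> N n)" for \<omega> n
  have PN: "?P \<omega> (N \<omega> n) n" for \<omega> n
    unfolding N_def using ex by (rule LeastI_ex)
  have recN: "recursive 1 (\<lambda>\<omega> xs. N \<omega> (xs ! 0))"
    unfolding N_def
  proof (rule recursive_Least)
    show "decidable (Suc 1) (\<lambda>\<omega> zs. \<forall>s<2 ^ zs ! 0. m (finite_oracle (drop 1 zs ! 0) s \<omega>)
        [Suc (drop 1 zs ! 0), Suc (drop 1 zs ! 0)] \<le> zs ! 0)"
      by (intro decidable_all_less decidable_le recursive_finite_oracle[OF m(1)] recursive_intros) auto
  qed (rule ex)
  define q where "q \<omega> xs = (\<Sum>s<2 ^ N \<omega> (xs ! 0). rat_enum (f (finite_oracle (xs ! 0) s \<omega>)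
      [Suc (xs ! 0), Suc (xs ! 0)])) * (1 / of_nat (2 ^ N \<omega> (xs ! 0)))" for \<omega> xs
  show ?thesis
  proof (rule that)
    show "recursive_rat 1 q"
      unfolding q_def
      by (intro recursive_rat_mult recursive_rat_sum recursive_rat_inverse_of_nat recursive_rat_enum
          recursive_finite_oracle[OF f] recN recursive_intros) auto
    fix n :: nat and \<omega> :: point
    define Or where "Or x = (\<lambda>i j. if i < n then \<omega> i j else i = n \<and> x j)" for x :: "nat \<Rightarrow> bool"
    \<comment> \<open>The integration variable fills the rows from \<open>n\<close> on, but zeros
      then overwrite all of them except its row 0.\<close>
    have 1: "comb_seq (Suc n) (comb_seq n \<omega> \<xi>) (\<lambda>_ _. False) = Or (\<xi> 0)" for \<xi>
      by (auto simp: comb_seq_def Or_def fun_eq_iff less_Suc_eq)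
    have 2: "finite_oracle n s \<omega> = Or (bit s)" for s
      by (simp add: Or_def finite_oracle_def)
    let ?g = "\<lambda>x. f (Or x) [Suc n, Suc n]"
    \<comment> \<open>The modulus is known only at the test row \<open>bit s\<close>, so every row
      is compared with the test row that shares its first bits.\<close>
    have det: "?g x = ?g (bit s)" if "s < 2 ^ N \<omega> n" "\<forall>j<N \<omega> n. bit s j = x j" for x and s :: nat
    proof (rule m(2))
      have "m (Or (bit s)) [Suc n, Suc n] \<le> N \<omega> n" using PN[of \<omega> n] that(1) by (simp add: 2)
      then show "agree (m (Or (bit s)) [Suc n, Suc n]) (Or (bit s)) (Or x)"
        using that(2) by (auto simp: agree_def Or_def)
    qed simp
    have "cond_E n (\<lambda>\<omega>. of_rat (rat_enum (f (comb_seq (Suc n) \<omega> (\<lambda>_ _. False)) [Suc n, Suc n]))) \<omega>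
        = (\<integral>\<xi>. of_rat (rat_enum (?g (\<xi> 0))) \<partial>unif)"
      by (simp add: cond_E_def 1)
    also have "\<dots> = (\<Sum>s::nat<2 ^ N \<omega> n. of_rat (rat_enum (?g (bit s)))) / 2 ^ N \<omega> n"
    proof (rule integral_first_bits)
      fix x y :: "nat \<Rightarrow> bool" assume xy: "\<And>j. j < N \<omega> n \<Longrightarrow> x j = y j"
      obtain s :: nat where s: "s < 2 ^ N \<omega> n" "\<forall>j<N \<omega> n. bit s j = x j"
        using ex1_implies_ex[OF ex1_bit_eq[of "N \<omega> n" x]] by auto
      have "?g x = ?g (bit s)" using s by (rule det)
      moreover have "?g y = ?g (bit s)" by (rule det[OF s(1)]) (simp add: s(2) xy)
      ultimately show "(of_rat (rat_enum (?g x)) :: real) = of_rat (rat_enum (?g y))" by simp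
    qed
    also have "\<dots> = of_rat (q \<omega> [n])"
      by (simp add: q_def 2 of_rat_mult of_rat_sum of_rat_divide of_rat_power)
    finally show "cond_E n (\<lambda>\<omega>. of_rat (rat_enum (f (comb_seq (Suc n) \<omega> (\<lambda>_ _. False)) [Suc n, Suc n]))) \<omega>
       = of_rat (q \<omega> [n])" .
  qed
qed

section \<open>Rational-valued martingales\<close>

text \<open>By the tower property, fairness of each single step makes the increment
  \<open>D \<omega> [n]\<close> average to zero given any smaller number of rows.\<close>

lemma rational_computable_martingale_sum:
  assumes D: "recursive_rat 1 D"
    and adapted: "\<And>n \<omega> \<xi>. D (comb_seq (Suc n) \<omega> \<xi>) [n] = D \<omega> [n]"
    and fair: "\<And>n \<omega>. cond_E n (\<lambda>\<omega>. of_rat (D \<omega> [n])) \<omega> = 0"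
  shows "rational_computable_martingale (\<lambda>n \<omega>. of_rat (c + (\<Sum>i<n. D \<omega> [i])))"
proof -
  define M :: "nat \<Rightarrow> point \<Rightarrow> real" where "M = (\<lambda>n \<omega>. of_rat (c + (\<Sum>i<n. D \<omega> [i])))"
  have "recursive_rat 1 (\<lambda>\<omega> xs. c + (\<Sum>i<xs ! 0. D \<omega> [i]))"
    by (intro recursive_rat_add recursive_rat_const recursive_rat_sum recursive_rat_comp1[OF D]
        recursive_proj) auto
  then obtain g where g: "recursive 1 g"
      "\<And>\<omega> xs. length xs = 1 \<Longrightarrow> c + (\<Sum>i<xs ! 0. D \<omega> [i]) = rat_enum (g \<omega> xs)"
    unfolding recursive_rat_def by blast
  have M_g: "M n \<omega> = of_rat (rat_enum (g \<omega> [n]))" for n \<omega>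
    using g(2)[of "[n]" \<omega>] by (simp add: M_def)
  have M_fin: "finitely_determined (M n)" for n
    unfolding M_g[abs_def]
    by (rule finitely_determined_compose[OF finitely_determined_recursive[OF g(1)]]) simp
  obtain h where h: "recursive 1 h" "\<And>\<omega> xs. length xs = 1 \<Longrightarrow> D \<omega> xs = rat_enum (h \<omega> xs)"
    using D unfolding recursive_rat_def by blast
  have D_fin: "finitely_determined (\<lambda>\<omega>. of_rat (D \<omega> [n]) :: real)" for n
    unfolding h(2)[of "[n]", simplified]
    by (rule finitely_determined_compose[OF finitely_determined_recursive[OF h(1)]]) simp
  have D_comb: "D (comb_seq n \<omega> \<xi>) [i] = D \<omega> [i]" if "i < n" for i n \<omega> \<xi>
    using adapted[of i "comb_seq n \<omega> \<xi>" \<xi>] adapted[of i \<omega> \<xi>] that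
    by (simp add: comb_seq_absorb)
  have M_comb: "M n (comb_seq n \<omega> \<xi>) = M n \<omega>" for n \<omega> \<xi>
    by (simp add: M_def D_comb)
  have cond: "cond_E m (M n) \<omega> = M m \<omega>" if "m \<le> n" for m n \<omega>
    using that
  proof (induction n rule: dec_induct)
    case base
    have "prob_space.expectation unif (\<lambda>_. M m \<omega>) = M m \<omega>"
      using unif.prob_space by (simp add: space_unif)
    then show ?case by (simp add: cond_E_def M_comb)
  next
    case (step n)
    have "cond_E m (M (Suc n)) \<omega> = (\<integral>\<xi>. M n (comb_seq m \<omega> \<xi>) + of_rat (D (comb_seq m \<omega> \<xi>) [n]) \<partial>unif)"
      by (simp add: cond_E_def M_def of_rat_add of_rat_sum add_ac)
    also have "\<dots> = cond_E m (M n) \<omega> + cond_E m (\<lambda>\<omega>. of_rat (D \<omega> [n])) \<omega>"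
      unfolding cond_E_def
      by (intro Bochner_Integration.integral_add integrable_finitely_determined
          finitely_determined_comb_seq(1)[OF M_fin] finitely_determined_comb_seq(1)[OF D_fin])
    also have "cond_E m (\<lambda>\<omega>. of_rat (D \<omega> [n])) \<omega> = cond_E m (cond_E n (\<lambda>\<omega>. of_rat (D \<omega> [n]))) \<omega>"
      using cond_E_cond_E[OF D_fin] step by simp
    also have "\<dots> = 0" by (simp add: fair cond_E_def)
    finally show ?case using step by simp
  qed
  have "martingale M"
    unfolding martingale_def
  proof (intro conjI allI impI)
    show "integrable unif (M n)" for n by (rule integrable_finitely_determined[OF M_fin])
    show "\<exists>N. AE \<omega> in unif. \<forall>n. M n \<omega> = N n (map \<omega> [0..<n])"
    \<comment> \<open>The witness evaluates \<open>M n\<close> at the point whose rows are the list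
      followed by zero rows.\<close>
    proof (intro exI AE_I2 allI)
      fix \<omega> :: point and n
      have "(\<lambda>i. if i < n then map \<omega> [0..<n] ! i else (\<lambda>_. False)) = comb_seq n \<omega> (\<lambda>_ _. False)"
        by (auto simp: comb_seq_def fun_eq_iff)
      then show "M n \<omega> = (\<lambda>n xs. M n (\<lambda>i. if i < n then xs ! i else (\<lambda>_. False))) n (map \<omega> [0..<n])"
        by (simp add: M_comb)
    qed
    show "AE \<omega> in unif. cond_E m (M n) \<omega> = M m \<omega>" if "m \<le> n" for m n
      using cond[OF that] by simp
  qed
  moreover obtain G where "recursive_functional 1 G" "\<And>\<omega> xs. length xs = 1 \<Longrightarrow> g \<omega> xs = G \<omega> xs"
    using g(1) unfolding recursive_def by blast
  ultimately show ?thesis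
    unfolding rational_computable_martingale_def M_def[symmetric]
    by (intro conjI exI[of _ G]) (simp_all add: M_g)
qed

text \<open>\<open>G\<close> may query every row, but the case \<open>m = n\<close> of the
  martingale property, now valid everywhere, equates \<open>M n\<close> with
  \<open>cond_E n (M n)\<close>, which sees only the rows below \<open>n\<close>.\<close>

lemma rational_computable_martingaleD:
  assumes "rational_computable_martingale M"
  obtains q where "recursive_rat 1 q" "\<And>n \<omega>. M n \<omega> = of_rat (q \<omega> [n])"
    and "\<And>n. finitely_determined (M n)"
    and "\<And>m n \<omega>. m \<le> n \<Longrightarrow> cond_E m (M n) \<omega> = M m \<omega>"
    and "\<And>n \<omega> \<xi>. M n (comb_seq n \<omega> \<xi>) = M n \<omega>"
proof -
  obtain G where G: "recursive_functional 1 G" and MG: "\<And>n \<omega>. M n \<omega> = of_rat (rat_enum (G \<omega> [n]))"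
    and mart: "martingale M"
    using assms unfolding rational_computable_martingale_def by blast
  have recG: "recursive 1 G" using G by (rule recursive_functional_imp_recursive)
  have fin: "finitely_determined (M n)" for n
    unfolding MG[abs_def]
    by (rule finitely_determined_compose[OF finitely_determined_recursive[OF recG]]) simp
  have cond: "cond_E m (M n) \<omega> = M m \<omega>" if "m \<le> n" for m n \<omega>
  proof (rule AE_imp_everywhere[where P = "\<lambda>\<omega>. cond_E m (M n) \<omega> = M m \<omega>"])
    show "AE \<omega> in unif. cond_E m (M n) \<omega> = M m \<omega>"
      using mart that unfolding martingale_def by blast
    show "finitely_determined (\<lambda>\<omega>. cond_E m (M n) \<omega> = M m \<omega>)"
      by (intro finitely_determined_compose2[where h = "(=)"] finitely_determined_cond_E fin)
  qed
  have "M n (comb_seq n \<omega> \<xi>) = M n \<omega>" for n \<omega> \<xi>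
  proof -
    have "cond_E n (M n) (comb_seq n \<omega> \<xi>) = cond_E n (M n) \<omega>"
      by (simp add: cond_E_def comb_seq_absorb)
    then show ?thesis by (simp add: cond)
  qed
  with that[OF recursive_rat_enum[OF recG] MG fin cond] show ?thesis by blast
qed

text \<open>Zeros in the rows from \<open>n\<close> on do not change \<open>M n\<close>, so
  \<open>G\<close> may be run on the padded point; its exact value meets every precision
  \<open>k\<close>.\<close>

lemma rational_computable_imp_computable_martingale:
  assumes "rational_computable_martingale M"
  shows "computable_martingale M"
proof -
  obtain G where G: "recursive_functional 1 G" and MG: "\<And>n \<omega>. M n \<omega> = of_rat (rat_enum (G \<omega> [n]))"
    and mart: "martingale M"
    using assms unfolding rational_computable_martingale_def by blast
  have "recursive 2 (\<lambda>\<omega> xs. G \<omega> [xs ! 0])"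
    by (intro recursive_comp1 recursive_functional_imp_recursive[OF G] recursive_proj) simp
  then obtain F where F: "recursive_functional 2 F" "\<And>\<omega> xs. length xs = 2 \<Longrightarrow> G \<omega> [xs ! 0] = F \<omega> xs"
    unfolding recursive_def by blast
  have comb: "M n (comb_seq n \<omega> \<xi>) = M n \<omega>" for n \<omega> \<xi>
    using rational_computable_martingaleD[OF assms] by metis
  have "M n \<omega> = of_rat (rat_enum (F (comb_seq n \<omega> (\<lambda>_ _. False)) [n, k]))" for n k \<omega>
  proof -
    have "M n \<omega> = M n (comb_seq n \<omega> (\<lambda>_ _. False))" by (simp only: comb)
    then show ?thesis
      using F(2)[of "[n, k]" "comb_seq n \<omega> (\<lambda>_ _. False)"] by (simp add: MG)
  qed
  then show ?thesis
    unfolding computable_martingale_def using mart F(1) by (intro conjI exI[of _ F]) auto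
qed

section \<open>Rational approximation of a computable martingale\<close>

lemma integral_unif_abs_diff_le:
  fixes f g :: "point \<Rightarrow> real"
  assumes "integrable unif f" "integrable unif g" "\<And>\<xi>. \<bar>f \<xi> - g \<xi>\<bar> \<le> e"
  shows "\<bar>(\<integral>\<xi>. f \<xi> \<partial>unif) - (\<integral>\<xi>. g \<xi> \<partial>unif)\<bar> \<le> e"
proof -
  have "\<bar>(\<integral>\<xi>. f \<xi> \<partial>unif) - (\<integral>\<xi>. g \<xi> \<partial>unif)\<bar> = \<bar>\<integral>\<xi>. f \<xi> - g \<xi> \<partial>unif\<bar>"
    using assms by simp
  also have "\<dots> \<le> (\<integral>\<xi>. \<bar>f \<xi> - g \<xi>\<bar> \<partial>unif)" by (rule integral_abs_bound)
  also have "\<dots> \<le> (\<integral>\<xi>. e \<partial>unif)"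
    using assms by (intro integral_mono) auto
  also have "\<dots> = e" using unif.prob_space by simp
  finally show ?thesis .
qed

text \<open>
  The approximation \<open>A n\<close> of \<open>M n\<close> to within \<open>2 ^ - n\<close> is locally constant, so \<open>cond_E n (A (Suc n))\<close>
  is a computable rational; summing the fair increments \<open>A (Suc n) - cond_E n (A (Suc n))\<close> gives a
  rational martingale, which differs from \<open>A n\<close> by a constant and the partial sums of the absolutely
  convergent series of the drifts \<open>e n\<close>. The constant 5 covers the error \<open>2 ^ - n \<le> 1\<close> plus the total drift, at most 4.
\<close>

lemma rational_approximation:
  assumes "computable_martingale M" "nonneg M"
  obtains L where "rational_computable_martingale L" "nonneg L"
    "\<And>\<omega>. convergent (\<lambda>n. L n \<omega>) \<Longrightarrow> convergent (\<lambda>n. M n \<omega>)"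
proof -
  obtain F where F: "recursive_functional 2 F" and MF: "\<And>n k \<omega>.
      \<bar>M n \<omega> - of_rat (rat_enum (F (comb_seq n \<omega> (\<lambda>_ _. False)) [n, k]))\<bar> \<le> 1 / 2 ^ k"
    and mart: "martingale M"
    using assms(1) unfolding computable_martingale_def by blast
  have recF: "recursive 2 F" using F by (rule recursive_functional_imp_recursive)
  define a where "a \<omega> xs = rat_enum (F (comb_seq (xs ! 0) \<omega> (\<lambda>_ _. False)) [xs ! 0, xs ! 0])"
    for \<omega> xs
  define A :: "nat \<Rightarrow> point \<Rightarrow> real" where "A n \<omega> = of_rat (a \<omega> [n])" for n \<omega>
  obtain q where q: "recursive_rat 1 q" "\<And>n \<omega>. cond_E n (A (Suc n)) \<omega> = of_rat (q \<omega> [n])"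
    using recursive_cond_E[OF recF] unfolding A_def[abs_def] a_def nth_Cons_0 by blast
  have rec_a: "recursive_rat 1 a"
    unfolding a_def comb_seq_False_eq_finite_oracle
    by (intro recursive_rat_enum recursive_finite_oracle[OF recF] recursive_intros) auto
  have A_fin: "finitely_determined (A n)" for n
    unfolding A_def a_def
    by (rule finitely_determined_compose[OF finitely_determined_comb_seq(2)[OF finitely_determined_recursive[OF recF]]])
       simp
  have A_comb: "a (comb_seq n \<omega> \<xi>) [n] = a \<omega> [n]" for n \<omega> \<xi>
    by (simp add: a_def comb_seq_absorb)
  have MA: "\<bar>M n \<omega> - A n \<omega>\<bar> \<le> 1 / 2 ^ n" for n \<omega>
    using MF[of n \<omega> n] by (simp add: A_def a_def)
  define e where "e n \<omega> = cond_E n (A (Suc n)) \<omega> - A n \<omega>" for n \<omega>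
  \<comment> \<open>Where \<open>M\<close> is fair, \<open>e n\<close> is the error of
    \<open>A (Suc n)\<close> averaged by \<open>cond_E n\<close> plus the error of
    \<open>A n\<close>, at most \<open>1 / 2 ^ Suc n + 1 / 2 ^ n\<close>. Since \<open>e n\<close>
    is finitely determined, the bound passes from almost all points to all.\<close>
  have e: "\<bar>e n \<omega>\<bar> \<le> 2 * (1 / 2) ^ n" for n \<omega>
  proof (rule AE_imp_everywhere[where P = "\<lambda>\<omega>. \<bar>e n \<omega>\<bar> \<le> 2 * (1 / 2) ^ n"])
    show "finitely_determined (\<lambda>\<omega>. \<bar>e n \<omega>\<bar> \<le> 2 * (1 / 2) ^ n)"
      unfolding e_def
      by (intro finitely_determined_compose2[where h = "\<lambda>x y. \<bar>x - y\<bar> \<le> 2 * (1 / 2) ^ n"]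
          finitely_determined_cond_E A_fin)
    have ae: "AE \<omega> in unif. cond_E n (M (Suc n)) \<omega> = M n \<omega>"
      using mart unfolding martingale_def by simp
    have meas: "M (Suc n) \<in> borel_measurable unif"
      using mart unfolding martingale_def by blast
    have "\<bar>e n \<omega>\<bar> \<le> 2 * (1 / 2) ^ n" if eq: "cond_E n (M (Suc n)) \<omega> = M n \<omega>" for \<omega>
    proof -
      obtain b where b: "\<And>\<omega>. \<bar>A (Suc n) \<omega>\<bar> \<le> b"
        using bounded_finitely_determined[OF A_fin] by blast
      \<comment> \<open>Integrability of \<open>M (Suc n)\<close> alone would not give it for every
        section; closeness to the bounded \<open>A (Suc n)\<close> does.\<close>
      have "\<bar>M (Suc n) \<omega>\<bar> \<le> b + 1 / 2 ^ Suc n" for \<omega>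
        using MA[of "Suc n" \<omega>] b[of \<omega>] by linarith
      then have "integrable unif (\<lambda>\<xi>. M (Suc n) (comb_seq n \<omega> \<xi>))"
        by (intro integrable_bounded_unif measurable_compose[OF measurable_comb_seq_unif meas])
      then have "\<bar>cond_E n (M (Suc n)) \<omega> - cond_E n (A (Suc n)) \<omega>\<bar> \<le> 1 / 2 ^ Suc n"
        unfolding cond_E_def
        by (rule integral_unif_abs_diff_le[OF _ integrable_finitely_determined[OF
              finitely_determined_comb_seq(1)[OF A_fin]] MA])
      moreover have "1 / 2 ^ Suc n \<le> (1 / 2 ^ n :: real)" by (simp add: field_simps)
      ultimately have "\<bar>e n \<omega>\<bar> \<le> 2 * (1 / 2 ^ n)"
        using MA[of n \<omega>] eq unfolding e_def by linarith
      then show ?thesis by (simp add: power_one_over)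
    qed
    then show "AE \<omega> in unif. \<bar>e n \<omega>\<bar> \<le> 2 * (1 / 2) ^ n"
      using AE_mp[OF ae] by (metis (mono_tags, lifting) AE_I2)
  qed
  have summable_e: "summable (\<lambda>n. e n \<omega>)" for \<omega>
    by (rule summable_comparison_test[of _ "\<lambda>n. 2 * (1 / 2) ^ n"])
      (use e in \<open>auto intro!: summable_mult summable_geometric\<close>)
  have sum_e: "(\<Sum>i<n. e i \<omega>) \<le> 4" for n \<omega>
  proof -
    have "(\<Sum>i<n. e i \<omega>) \<le> (\<Sum>i<n. 2 * (1 / 2 :: real) ^ i)"
      using e[of _ \<omega>] by (intro sum_mono) (auto dest: abs_le_D1)
    also have "\<dots> \<le> (\<Sum>i. 2 * (1 / 2 :: real) ^ i)"
      by (intro sum_le_suminf summable_mult summable_geometric) auto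
    also have "\<dots> = 4" by (simp add: suminf_mult suminf_geometric summable_geometric)
    finally show ?thesis .
  qed
  define D where "D \<omega> xs = a \<omega> [Suc (xs ! 0)] - q \<omega> [xs ! 0]" for \<omega> xs
  have D_A: "of_rat (D \<omega> [n]) = A (Suc n) \<omega> - cond_E n (A (Suc n)) \<omega>" for n \<omega>
    by (simp add: D_def A_def q of_rat_diff)
  have D_e: "of_rat (D \<omega> [n]) = A (Suc n) \<omega> - A n \<omega> - e n \<omega>" for n \<omega>
    by (simp add: D_A e_def)
  \<comment> \<open>\<open>A 0\<close> reads no row, so its value at the zero point is its value
    everywhere and can enter a constant.\<close>
  define c where "c = a (\<lambda>_ _. False) [0] + 5"
  define L where "L = (\<lambda>n \<omega>. of_rat (c + (\<Sum>i<n. D \<omega> [i])) :: real)"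
  have L_A: "L n \<omega> = A n \<omega> + 5 - (\<Sum>i<n. e i \<omega>)" for n \<omega>
  proof -
    have "a \<omega> [0] = a (\<lambda>_ _. False) [0]" by (simp add: a_def comb_seq_0)
    then have "L 0 \<omega> = A 0 \<omega> + 5" by (simp add: L_def c_def A_def of_rat_add)
    moreover have "L (Suc n) \<omega> = L n \<omega> + of_rat (D \<omega> [n])" for n
      by (simp add: L_def of_rat_add)
    ultimately show ?thesis by (induction n) (simp_all add: D_e)
  qed
  have "rational_computable_martingale L"
    unfolding L_def
  proof (rule rational_computable_martingale_sum)
    show "recursive_rat 1 D"
      unfolding D_def
      by (intro recursive_rat_diff recursive_rat_comp1[OF rec_a] recursive_rat_comp1[OF q(1)]
          recursive_intros) auto
    fix n \<omega>
    have "cond_E n (A (Suc n)) (comb_seq (Suc n) \<omega> \<xi>) = cond_E n (A (Suc n)) \<omega>" for \<xi>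
      by (simp add: cond_E_def comb_seq_absorb)
    then show "D (comb_seq (Suc n) \<omega> \<xi>) [n] = D \<omega> [n]" for \<xi>
      by (simp add: D_def A_comb q(2))
    have "cond_E n (\<lambda>\<omega>. of_rat (D \<omega> [n])) \<omega> = cond_E n (A (Suc n)) \<omega> - cond_E n (cond_E n (A (Suc n))) \<omega>"
      unfolding D_A unfolding cond_E_def[of n "A (Suc n)" \<omega>] cond_E_def[of n _ \<omega>]
      by (intro Bochner_Integration.integral_diff integrable_finitely_determined
          finitely_determined_comb_seq(1) finitely_determined_cond_E A_fin)
    then show "cond_E n (\<lambda>\<omega>. of_rat (D \<omega> [n])) \<omega> = 0"
      by (simp add: cond_E_cond_E[OF A_fin])
  qed
  moreover have "nonneg L"
    unfolding nonneg_def
  proof (intro allI)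
    fix n \<omega>
    have "0 \<le> M n \<omega>" using assms(2) unfolding nonneg_def by blast
    moreover have "1 / 2 ^ n \<le> (1 :: real)" by simp
    ultimately have "- 1 \<le> A n \<omega>" using MA[of n \<omega>] by linarith
    then show "0 \<le> L n \<omega>" using sum_e[where n = n and \<omega> = \<omega>] by (simp add: L_A)
  qed
  moreover have "convergent (\<lambda>n. M n \<omega>)" if "convergent (\<lambda>n. L n \<omega>)" for \<omega>
  proof -
    have "(\<lambda>n. M n \<omega> - A n \<omega>) \<longlonglongrightarrow> 0"
    proof (rule Lim_null_comparison)
      show "\<forall>\<^sub>F n in sequentially. norm (M n \<omega> - A n \<omega>) \<le> (1 / 2) ^ n"
        using MA by (auto simp: power_one_over)
      show "(\<lambda>n. (1 / 2 :: real) ^ n) \<longlonglongrightarrow> 0" by (rule LIMSEQ_realpow_zero) auto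
    qed
    then have 1: "convergent (\<lambda>n. M n \<omega> - A n \<omega>)" by (rule convergentI)
    have 2: "convergent (\<lambda>n. \<Sum>i<n. e i \<omega>)" using summable_e by (simp add: summable_iff_convergent)
    have eq: "(\<lambda>n. M n \<omega>) = (\<lambda>n. (M n \<omega> - A n \<omega>) + (L n \<omega> + (\<Sum>i<n. e i \<omega>)) - 5)"
      by (rule ext) (simp add: L_A)
    show ?thesis
      by (subst eq) (intro convergent_diff convergent_add convergent_const 1 2 that)
  qed
  ultimately show ?thesis using that by blast
qed

section \<open>The upcrossing strategy\<close>

text \<open>
  The strategy keeps at most one share: it buys when the price is below \<open>a\<close> and sells when it is
  above \<open>b\<close>. Since it never holds more than one share, the profits already made are never at risk,
  so the capital tends to infinity, which a multiplicative strategy would not guarantee.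
\<close>

fun holding :: "'a :: linorder \<Rightarrow> 'a \<Rightarrow> (nat \<Rightarrow> 'a) \<Rightarrow> nat \<Rightarrow> bool" where
  "holding a b x 0 \<longleftrightarrow> x 0 < a"
| "holding a b x (Suc n) \<longleftrightarrow> (if holding a b x n then \<not> b < x (Suc n) else x (Suc n) < a)"

fun upcrossings :: "'a :: linorder \<Rightarrow> 'a \<Rightarrow> (nat \<Rightarrow> 'a) \<Rightarrow> nat \<Rightarrow> nat" where
  "upcrossings a b x 0 = 0"
| "upcrossings a b x (Suc n) = upcrossings a b x n + of_bool (holding a b x n \<and> b < x (Suc n))"

text \<open>The martingale transform of the price by the holdings. The initial capital
  \<open>a\<close> covers the first purchase, made at a price below \<open>a\<close>.\<close>

definition capital :: "'a :: linordered_field \<Rightarrow> 'a \<Rightarrow> (nat \<Rightarrow> 'a) \<Rightarrow> nat \<Rightarrow> 'a" where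
  "capital a b x n = a + (\<Sum>i<n. of_bool (holding a b x i) * (x (Suc i) - x i))"

lemma holding_cong: "(\<And>i. i \<le> n \<Longrightarrow> x i = y i) \<Longrightarrow> holding a b x n = holding a b y n"
  by (induction n) auto

text \<open>Links the strategy, decided on rationals, with the estimates, made for the real-valued
  process.\<close>

lemma holding_of_rat:
  "holding (of_rat a) (of_rat b) (\<lambda>n. of_rat (x n) :: real) n = holding a b x n"
  by (induction n) (auto simp: of_rat_less)

text \<open>The bound is an invariant. A purchase replaces \<open>a\<close> by a smaller price, a
  held share moves both sides equally, and a sale above \<open>b\<close> pays for the new upcrossing
  because \<open>b = (b - a) + a\<close>.\<close>

lemma capital_ge:
  "(b - a) * of_nat (upcrossings a b x n) + (if holding a b x n then x n else a) \<le> capital a b x n"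
proof (induction n)
  case (Suc n)
  then show ?case by (auto simp: capital_def algebra_simps)
qed (simp add: capital_def)

text \<open>A price below \<open>a\<close> ensures that a share is held, and without a sale it would
  still be held just before the next price above \<open>b\<close>, which triggers a sale.\<close>

lemma infinitely_many_upcrossings:
  assumes below: "\<exists>\<^sub>F n in sequentially. x n < a" and above: "\<exists>\<^sub>F n in sequentially. b < x n"
    and "a < b"
  shows "\<exists>n. k \<le> upcrossings a b x n"
proof (induction k)
  case (Suc k)
  then obtain n where n: "k \<le> upcrossings a b x n" by blast
  have "incseq (upcrossings a b x)" by (rule incseq_SucI) simp
  then have mono: "upcrossings a b x i \<le> upcrossings a b x j" if "i \<le> j" for i j
    using that by (rule incseqD)
  obtain i where i: "n < i" "x i < a"
    using below unfolding frequently_sequentially by (metis Suc_le_lessD)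
  \<comment> \<open>At a time \<open>i\<close> with price below \<open>a\<close>, a share was either
    held at \<open>i - 1\<close> or is bought at \<open>i\<close>; the strict \<open>n < i\<close>
    puts both times at or after \<open>n\<close>.\<close>
  have "\<exists>m\<ge>n. holding a b x m"
  proof -
    obtain i' where i': "i = Suc i'" using i(1) by (cases i) auto
    show ?thesis
    proof (cases "holding a b x i'")
      case True
      then show ?thesis using i i' by (intro exI[of _ i']) simp
    next
      case False
      then show ?thesis using i i' by (intro exI[of _ i]) simp
    qed
  qed
  then obtain m where m: "n \<le> m" "holding a b x m" by blast
  obtain j where j: "m < j" "b < x j"
    using above unfolding frequently_sequentially by (metis Suc_le_lessD)
  have "\<exists>l\<ge>m. holding a b x l \<and> b < x (Suc l)"
  proof (rule ccontr)
    assume no: "\<not> ?thesis"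
    have "holding a b x (m + d)" for d
    proof (induction d)
      case (Suc d)
      then show ?case using no by auto
    qed (use m in simp)
    from this[of "j - 1 - m"] have "holding a b x (j - 1)" using j by simp
    then show False using no j by (auto dest!: spec[of _ "j - 1"])
  qed
  then obtain l where "m \<le> l" "holding a b x l" "b < x (Suc l)" by blast
  then have "Suc k \<le> upcrossings a b x (Suc l)"
    using n mono[of n l] m by simp
  then show ?case by blast
qed simp

text \<open>The lower bound of \<open>capital_ge\<close> grows with the number of upcrossings, which
  never decreases; hence a limit and not merely large values now and then.\<close>

lemma liminf_capital:
  fixes x :: "nat \<Rightarrow> real"
  assumes "\<exists>\<^sub>F n in sequentially. x n < a" "\<exists>\<^sub>F n in sequentially. b < x n" "a < b"
    and "0 \<le> a" "\<And>n. 0 \<le> x n"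
  shows "liminf (\<lambda>n. ereal (capital a b x n)) = \<infinity>"
proof -
  have "filterlim (capital a b x) at_top sequentially"
    unfolding filterlim_at_top
  proof
    fix Z
    obtain k where k: "Z / (b - a) \<le> real k" using real_arch_simple by blast
    obtain n where n: "k \<le> upcrossings a b x n"
      using infinitely_many_upcrossings[OF assms(1-3)] by blast
    have inc: "incseq (upcrossings a b x)" by (rule incseq_SucI) simp
    have "Z \<le> capital a b x m" if "n \<le> m" for m
    proof -
      have "Z / (b - a) \<le> real (upcrossings a b x m)"
        using k n incseqD[OF inc that] by linarith
      then have "Z \<le> (b - a) * real (upcrossings a b x m)"
        using \<open>a < b\<close> by (simp add: field_simps)
      also have "\<dots> \<le> capital a b x m"
        using capital_ge[of b a x m] assms(4,5) by (auto split: if_splits intro: order_trans[rotated])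
      finally show ?thesis .
    qed
    then show "\<forall>\<^sub>F n in sequentially. Z \<le> capital a b x n"
      unfolding eventually_sequentially by blast
  qed
  then have "(\<lambda>n. ereal (capital a b x n)) \<longlonglongrightarrow> \<infinity>"
    by (simp add: tendsto_PInfty_eq_at_top)
  then show ?thesis by (simp add: lim_imp_Liminf)
qed

text \<open>If the lower and upper limits coincide, the common value is neither finite nor negative.
  Otherwise the gap between them contains two rationals.\<close>

lemma divergent_cases:
  fixes x :: "nat \<Rightarrow> real"
  assumes "\<And>n. 0 \<le> x n" "\<not> convergent x"
  obtains "liminf (\<lambda>n. ereal (x n)) = \<infinity>"
  | a b :: rat where "0 \<le> a" "a < b" "\<exists>\<^sub>F n in sequentially. x n < of_rat a"
      "\<exists>\<^sub>F n in sequentially. of_rat b < x n"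
proof (cases "liminf (\<lambda>n. ereal (x n)) = limsup (\<lambda>n. ereal (x n))")
  case True
  let ?l = "liminf (\<lambda>n. ereal (x n))"
  have lim: "(\<lambda>n. ereal (x n)) \<longlonglongrightarrow> ?l"
    using True by (intro Liminf_eq_Limsup) auto
  have "0 \<le> ?l" using assms(1) by (intro Liminf_bounded) auto
  moreover have "?l \<noteq> ereal r" for r
    using lim assms(2) by (auto simp: convergent_def)
  ultimately have "?l = \<infinity>" by (cases ?l) auto
  then show ?thesis using that(1) by blast
next
  case False
  have nonneg: "0 \<le> liminf (\<lambda>n. ereal (x n))" using assms(1) by (intro Liminf_bounded) auto
  have "liminf (\<lambda>n. ereal (x n)) \<le> limsup (\<lambda>n. ereal (x n))" by (rule Liminf_le_Limsup) simp
  with False have "liminf (\<lambda>n. ereal (x n)) < limsup (\<lambda>n. ereal (x n))" by simp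
  then obtain a where a: "liminf (\<lambda>n. ereal (x n)) < ereal (of_rat a)"
      "ereal (of_rat a) < limsup (\<lambda>n. ereal (x n))"
    using ereal_dense3 by blast
  obtain b where b: "ereal (of_rat a) < ereal (of_rat b)" "ereal (of_rat b) < limsup (\<lambda>n. ereal (x n))"
    using ereal_dense3[OF a(2)] by blast
  have "ereal 0 < ereal (of_rat a)" using le_less_trans[OF nonneg a(1)] by simp
  show ?thesis
  proof (rule that(2))
    show "0 \<le> a" using \<open>ereal 0 < ereal (of_rat a)\<close> by simp
    show "a < b" using b(1) by (simp add: of_rat_less)
    show "\<exists>\<^sub>F n in sequentially. x n < of_rat a"
    proof (rule ccontr)
      assume "\<not> ?thesis"
      then have "\<forall>\<^sub>F n in sequentially. ereal (of_rat a) \<le> ereal (x n)"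
        by (simp add: not_frequently not_less)
      then have "ereal (of_rat a) \<le> liminf (\<lambda>n. ereal (x n))" by (rule Liminf_bounded)
      with a(1) show False by simp
    qed
    show "\<exists>\<^sub>F n in sequentially. of_rat b < x n"
    proof (rule ccontr)
      assume "\<not> ?thesis"
      then have "\<forall>\<^sub>F n in sequentially. ereal (x n) \<le> ereal (of_rat b)"
        by (simp add: not_frequently not_less)
      then have "limsup (\<lambda>n. ereal (x n)) \<le> ereal (of_rat b)" by (rule Limsup_bounded)
      with b(2) show False by simp
    qed
  qed
qed

text \<open>The thresholds \<open>a\<close> and \<open>b\<close> are chosen for the given point
  without an effective procedure; as constants of the strategy they leave it computable.\<close>

lemma rational_upcrossing_martingale:
  assumes L: "rational_computable_martingale L" "nonneg L" and "\<not> convergent (\<lambda>n. L n \<omega>)"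
  obtains K where "rational_computable_martingale K" "nonneg K" "liminf (\<lambda>n. ereal (K n \<omega>)) = \<infinity>"
proof -
  have L_nonneg: "0 \<le> L n \<omega>" for n \<omega> using L(2) unfolding nonneg_def by blast
  from L_nonneg assms(3) show ?thesis
  proof (cases rule: divergent_cases)
    case 1
    then show ?thesis using that[OF L] by simp
  next
    case (2 a b)
    obtain q where q: "recursive_rat 1 q" "\<And>n \<omega>. L n \<omega> = of_rat (q \<omega> [n])"
      and fin: "\<And>n. finitely_determined (L n)"
      and cond: "\<And>m n \<omega>. m \<le> n \<Longrightarrow> cond_E m (L n) \<omega> = L m \<omega>"
      and comb: "\<And>n \<omega> \<xi>. L n (comb_seq n \<omega> \<xi>) = L n \<omega>"
      using rational_computable_martingaleD[OF L(1)] by metis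
    let ?x = "\<lambda>\<omega> n. q \<omega> [n]"
    define D where "D \<omega> xs = of_bool (holding a b (?x \<omega>) (xs ! 0)) * (q \<omega> [Suc (xs ! 0)] - q \<omega> [xs ! 0])"
      for \<omega> xs
    define K where "K = (\<lambda>n \<omega>. of_rat (a + (\<Sum>i<n. D \<omega> [i])) :: real)"
    have K_capital: "K n \<omega> = capital (of_rat a) (of_rat b) (\<lambda>n. L n \<omega>) n" for n \<omega>
      unfolding K_def capital_def q(2) holding_of_rat D_def
      by (simp add: of_rat_add of_rat_sum of_rat_mult of_rat_diff)
    have hold_rec: "decidable 1 (\<lambda>\<omega> xs. holding a b (?x \<omega>) (xs ! 0))"
    proof -
      have "recursive 1 (\<lambda>\<omega> xs. rec_nat (of_bool (q \<omega> [0] < a))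
          (\<lambda>m r. if r = 1 then of_bool (\<not> b < q \<omega> [Suc m]) else of_bool (q \<omega> [Suc m] < a)) (xs ! 0))"
        by (intro recursive_rec_nat recursive_intros decidable_rat_less recursive_rat_comp1[OF q(1)]
            recursive_rat_const) auto
      moreover have "rec_nat (of_bool (q \<omega> [0] < a)) (\<lambda>m r. if r = 1 then of_bool (\<not> b < q \<omega> [Suc m])
          else of_bool (q \<omega> [Suc m] < a)) n = (of_bool (holding a b (?x \<omega>) n) :: nat)" for \<omega> n
        by (induction n) auto
      ultimately show ?thesis unfolding decidable_def by simp
    qed
    have q_comb: "q (comb_seq n \<omega> \<xi>) [i] = q \<omega> [i]" if "i \<le> n" for n i \<omega> \<xi>
    proof -
      have "L i (comb_seq n \<omega> \<xi>) = L i (comb_seq i (comb_seq n \<omega> \<xi>) \<xi>)" by (simp only: comb)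
      also have "\<dots> = L i \<omega>" using that by (simp add: comb_seq_absorb comb)
      finally show ?thesis by (simp add: q)
    qed
    have hold_comb: "holding a b (?x (comb_seq n \<omega> \<xi>)) i = holding a b (?x \<omega>) i" if "i \<le> n" for n i \<omega> \<xi>
      using that by (intro holding_cong q_comb) simp
    have "rational_computable_martingale K"
      unfolding K_def
    proof (rule rational_computable_martingale_sum)
      have "recursive_rat 1 (\<lambda>\<omega> xs. of_nat (of_bool (holding a b (?x \<omega>) (xs ! 0)))
          * (q \<omega> [Suc (xs ! 0)] - q \<omega> [xs ! 0]))"
        by (intro recursive_rat_mult recursive_rat_diff recursive_rat_of_nat recursive_of_bool hold_rec
            recursive_rat_comp1[OF q(1)] recursive_intros) auto
      then show "recursive_rat 1 D" unfolding D_def by simp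
      fix n \<omega>
      show "D (comb_seq (Suc n) \<omega> \<xi>) [n] = D \<omega> [n]" for \<xi>
        by (simp add: D_def q_comb hold_comb)
      \<comment> \<open>Holding at time \<open>n\<close> depends only on the rows below
        \<open>n\<close>, so it comes out of the conditional expectation as a factor.\<close>
      have "cond_E n (\<lambda>\<omega>. of_rat (D \<omega> [n])) \<omega> = (\<integral>\<xi>. of_bool (holding a b (?x \<omega>) n) *
          (L (Suc n) (comb_seq n \<omega> \<xi>) - L n (comb_seq n \<omega> \<xi>)) \<partial>unif)"
        by (simp add: cond_E_def D_def hold_comb of_rat_mult of_rat_diff q)
      also have "\<dots> = of_bool (holding a b (?x \<omega>) n) * (cond_E n (L (Suc n)) \<omega> - cond_E n (L n) \<omega>)"
        unfolding cond_E_def integral_mult_right_zero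
        by (subst Bochner_Integration.integral_diff)
          (auto intro!: integrable_finitely_determined finitely_determined_comb_seq(1) fin)
      also have "\<dots> = 0" by (simp add: cond)
      finally show "cond_E n (\<lambda>\<omega>. of_rat (D \<omega> [n])) \<omega> = 0" .
    qed
    moreover have "nonneg K"
      unfolding nonneg_def
    proof (intro allI)
      fix n \<omega>
      have "0 \<le> (real_of_rat b - of_rat a) * real (upcrossings (of_rat a) (of_rat b) (\<lambda>n. L n \<omega>) n)"
        using 2(2) by (simp add: of_rat_less_eq)
      then show "0 \<le> K n \<omega>"
        using capital_ge[of "of_rat b" "of_rat a" "\<lambda>n. L n \<omega>" n] 2(1) L_nonneg[of n \<omega>]
        unfolding K_capital by (auto split: if_splits intro: order_trans[rotated])
    qed
    moreover have "liminf (\<lambda>n. ereal (K n \<omega>)) = \<infinity>"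
      unfolding K_capital using 2 L_nonneg by (intro liminf_capital) (auto simp: of_rat_less)
    ultimately show ?thesis using that by blast
  qed
qed

theorem theorem4p8:
  fixes \<omega> :: "nat \<Rightarrow> nat \<Rightarrow> bool"
  shows
    "(\<not> Doob_random \<omega> \<longleftrightarrow>
        (\<exists>M. rational_computable_martingale M \<and> nonneg M \<and> \<not> convergent (\<lambda>n. M n \<omega>))) \<and>
     (\<not> Doob_random \<omega> \<longleftrightarrow>
        (\<exists>M. rational_computable_martingale M \<and> nonneg M \<and>
             limsup (\<lambda>n. ereal (M n \<omega>)) = \<infinity>)) \<and>
     (\<not> Doob_random \<omega> \<longleftrightarrow>
        (\<exists>M. rational_computable_martingale M \<and> nonneg M \<and>
             liminf (\<lambda>n. ereal (M n \<omega>)) = \<infinity>))"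
proof -
  \<comment> \<open>The labels name the implications of the cycle (1), (4), (3), (2), (1).\<close>
  have 14: "\<exists>M. rational_computable_martingale M \<and> nonneg M \<and> liminf (\<lambda>n. ereal (M n \<omega>)) = \<infinity>"
    if not_random: "\<not> Doob_random \<omega>"
  proof -
    obtain M where M: "computable_martingale M" "nonneg M" "\<not> convergent (\<lambda>n. M n \<omega>)"
      using not_random unfolding Doob_random_def by blast
    obtain L where L: "rational_computable_martingale L" "nonneg L" "\<not> convergent (\<lambda>n. L n \<omega>)"
      using rational_approximation[OF M(1,2)] M(3) by metis
    show ?thesis using rational_upcrossing_martingale[OF L] by metis
  qed
  have 43: "limsup (\<lambda>n. ereal (M n \<omega>)) = \<infinity>" if "liminf (\<lambda>n. ereal (M n \<omega>)) = \<infinity>" for M :: "nat \<Rightarrow> point \<Rightarrow> real"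
    using Liminf_le_Limsup[of sequentially "\<lambda>n. ereal (M n \<omega>)"] that by simp
  have 32: "\<not> convergent (\<lambda>n. M n \<omega>)" if "limsup (\<lambda>n. ereal (M n \<omega>)) = \<infinity>" for M :: "nat \<Rightarrow> point \<Rightarrow> real"
  proof
    assume "convergent (\<lambda>n. M n \<omega>)"
    then obtain l where "(\<lambda>n. ereal (M n \<omega>)) \<longlonglongrightarrow> ereal l" by (auto simp: convergent_def)
    then have "limsup (\<lambda>n. ereal (M n \<omega>)) = ereal l" by (simp add: lim_imp_Limsup)
    with that show False by simp
  qed
  have 21: "\<not> Doob_random \<omega>" if "rational_computable_martingale M" "nonneg M" "\<not> convergent (\<lambda>n. M n \<omega>)" for M
    using that rational_computable_imp_computable_martingale unfolding Doob_random_def by blast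
  show ?thesis using 14 43 32 21 by blast
qed

end
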